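(* Let $T$ be an interval exchange transformation with admissible combinatorial datum. Then $T$ is of bounded type (i.e. $\mathcal{E}(T)>0$) if and only if $T$ admits infinitely many iterations of the positive acceleration $Q_+$ of the Rauzy induction and the corresponding matrices $P_n(T)=P(Q_+^n(T))$ have norms uniformly bounded for $n\in\mathbb{N}$.
   Context: Let $\mathcal{A}$ be a finite alphabet with $d\ge2$ letters. A combinatorial datum $\pi=(\pi^t,\pi^b)$ is a pair of bijections $\mathcal{A}\to\{1,\dots,d\}$; it is admissible if there is no nonempty proper subset $\mathcal{A}'$ with $k<d$ elements and $\pi^t(\mathcal{A}')=\pi^b(\mathcal{A}')=\{1,\dots,k\}$. For $\lambda\in\mathbb{R}_+^{\mathcal{A}}$ the pair $(\pi,\lambda)$ determines the interval exchange transformation $T$ (IET) on $I=[0,\sum_\chi\lambda_\chi)$ translating, for each $\alpha$, the interval $[u^t_\alpha,u^t_\alpha+\lambda_\alpha)$ onto $[u^b_\alpha,u^b_\alpha+\lambda_\alpha)$, where $u^t_\alpha=\sum_{\pi^t(\chi)<\pi^t(\alpha)}\lambda_\chi$ and $u^b_\alpha=\sum_{\pi^b(\chi)<\pi^b(\alpha)}\lambda_\chi$. Bounded type: the singularities of $T^n$ are the points $T^{-i}(u^t_\alpha)$, $0\le i<n$, $\pi^t(\alpha)>1$, regarded as a family indexed by $(i,\alpha)$. $\mathcal{E}_n(T)$ is the minimum distance between two members of this family with different indices (so it is $0$ if two coincide), and $\mathcal{E}(T)=\liminf_{n\to\infty} n\,\mathcal{E}_n(T)/|I|$. Rauzy map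 $Q$: let $\alpha_t,\alpha_b$ be the letters with $\pi^t(\alpha_t)=\pi^b(\alpha_b)=d$; $Q(\pi,\lambda)$ is defined if $\lambda_{\alpha_t}\neq\lambda_{\alpha_b}$. Let $\epsilon=t$ if $\lambda_{\alpha_t}>\lambda_{\alpha_b}$, $\epsilon=b$ otherwise, and $1-\epsilon$ the other symbol. Then $Q(\pi,\lambda)=(\tilde\pi,\tilde\lambda)$ with $\tilde\pi^\epsilon=\pi^\epsilon$, $\tilde\pi^{1-\epsilon}$ obtained from $\pi^{1-\epsilon}$ by moving the last letter $\alpha_{1-\epsilon}$ immediately after $\alpha_\epsilon$, $\tilde\lambda_{\alpha_\epsilon}=\lambda_{\alpha_\epsilon}-\lambda_{\alpha_{1-\epsilon}}$, other entries unchanged. The step is recorded by an arrow with winner $\alpha_\epsilon$ and loser $\alpha_{1-\epsilon}$. To an arrow $\gamma$ with winner $\alpha$ and loser $\beta$ associate the matrix $B_\gamma$ with $B_\gamma e_\alpha=e_\alpha+e_\beta$, $B_\gamma e_\xi=e_\xi$ for $\xi\ne\alpha$, and put $B_{\gamma_1*\gamma_2}=B_{\gamma_2}B_{\gamma_1}$ for concatenations. A path $\gamma$ is positive if all entries of $B_\gamma$ are positive. Positive acceleration: let $\gamma(0,r)$ be the path of the first $r$ Rauzy steps of $T$, and let $\nu(T)=\gamma(0,r)$ for the smallest $r\ge1$ such that $\gamma(0,r)$ exists and is positive (if such $r$ exists). Then $Q_+(T)=Q^r(T)$ for this $r$, and $P(T)=B_{\nu(T)}$. The norm of a matrix is the maximum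 absolute value of its entries. *)

theory Defs
  imports "HOL-Analysis.Analysis"
begin

text \<open>The alphabet is a finite type, so \<open>d\<close> is its cardinality. An element of the record is
  a pair (combinatorial datum, length vector); well-formedness is \<open>is_iet\<close> below.\<close>

record 'a iet =
  ptop :: "'a \<Rightarrow> nat"
  pbot :: "'a \<Rightarrow> nat"
  len :: "'a \<Rightarrow> real"

definition is_iet :: "('a::finite) iet \<Rightarrow> bool" where
  "is_iet T \<longleftrightarrow> bij_betw (ptop T) UNIV {1..CARD('a)} \<and> bij_betw (pbot T) UNIV {1..CARD('a)}
     \<and> (\<forall>\<alpha>. len T \<alpha> > 0)"

definition admissible :: "('a::finite) iet \<Rightarrow> bool" where
  "admissible T \<longleftrightarrow>
     \<not> (\<exists>S. S \<noteq> {} \<and> S \<noteq> UNIV \<and> ptop T ` S = {1..card S} \<and> pbot T ` S = {1..card S})"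

definition total_len :: "('a::finite) iet \<Rightarrow> real" where
  "total_len T = (\<Sum>\<xi>\<in>UNIV. len T \<xi>)"

definition iet_dom :: "('a::finite) iet \<Rightarrow> real set" where
  "iet_dom T = {0..<total_len T}"

definition utop :: "('a::finite) iet \<Rightarrow> 'a \<Rightarrow> real" where
  "utop T \<alpha> = (\<Sum>\<xi> | ptop T \<xi> < ptop T \<alpha>. len T \<xi>)"

definition ubot :: "('a::finite) iet \<Rightarrow> 'a \<Rightarrow> real" where
  "ubot T \<alpha> = (\<Sum>\<xi> | pbot T \<xi> < pbot T \<alpha>. len T \<xi>)"

text \<open>Only the values on \<open>iet_dom T\<close> are meaningful.\<close>

definition iet_map :: "('a::finite) iet \<Rightarrow> real \<Rightarrow> real" where
  "iet_map T x =
     (let \<alpha> = (THE \<alpha>. x \<in> {utop T \<alpha>..<utop T \<alpha> + len T \<alpha>}) in x - utop T \<alpha> + ubot T \<alpha>)"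

definition sing_idx :: "('a::finite) iet \<Rightarrow> nat \<Rightarrow> (nat \<times> 'a) set" where
  "sing_idx T n = {(i, \<alpha>). i < n \<and> ptop T \<alpha> > 1}"

definition sing :: "('a::finite) iet \<Rightarrow> nat \<times> 'a \<Rightarrow> real" where
  "sing T = (\<lambda>(i, \<alpha>). (inv_into (iet_dom T) (iet_map T) ^^ i) (utop T \<alpha>))"

text \<open>The set below is empty only if \<open>n = 0\<close>, or \<open>n = 1\<close> and the alphabet has two letters;
  this does not affect the lower limit.\<close>

definition sep :: "('a::finite) iet \<Rightarrow> nat \<Rightarrow> real" where
  "sep T n = Min {dist (sing T p) (sing T q) | p q.
                    p \<in> sing_idx T n \<and> q \<in> sing_idx T n \<and> p \<noteq> q}"

definition sep_const :: "('a::finite) iet \<Rightarrow> ereal" where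
  "sep_const T = liminf (\<lambda>n. ereal (real n * sep T n / total_len T))"

definition bounded_type :: "('a::finite) iet \<Rightarrow> bool" where
  "bounded_type T \<longleftrightarrow> sep_const T > 0"

definition last_letter :: "('a::finite \<Rightarrow> nat) \<Rightarrow> 'a" where
  "last_letter p = (THE \<alpha>. p \<alpha> = CARD('a))"

text \<open>Moves the last letter \<open>l\<close> of the row \<open>p\<close> immediately after \<open>w\<close>.\<close>

definition move_after :: "'a \<Rightarrow> 'a \<Rightarrow> ('a \<Rightarrow> nat) \<Rightarrow> 'a \<Rightarrow> nat" where
  "move_after l w p = (\<lambda>\<xi>. if \<xi> = l then p w + 1 else if p \<xi> > p w then p \<xi> + 1 else p \<xi>)"

definition rauzy :: "('a::finite) iet \<Rightarrow> 'a iet option" where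
  "rauzy T =
    (let a = last_letter (ptop T); b = last_letter (pbot T) in
     if len T a > len T b then
       Some (T\<lparr>pbot := move_after b a (pbot T), len := (len T)(a := len T a - len T b)\<rparr>)
     else if len T b > len T a then
       Some (T\<lparr>ptop := move_after a b (ptop T), len := (len T)(b := len T b - len T a)\<rparr>)
     else None)"

text \<open>The pair (winner, loser); meaningful only if \<open>rauzy T \<noteq> None\<close>.\<close>

definition rauzy_arrow :: "('a::finite) iet \<Rightarrow> 'a \<times> 'a" where
  "rauzy_arrow T =
    (let a = last_letter (ptop T); b = last_letter (pbot T) in
     if len T a > len T b then (a, b) else (b, a))"

primrec iterate_partial :: "('b \<Rightarrow> 'b option) \<Rightarrow> nat \<Rightarrow> 'b \<Rightarrow> 'b option" where
  "iterate_partial f 0 x = Some x"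
| "iterate_partial f (Suc n) x = Option.bind (iterate_partial f n x) f"

text \<open>\<open>rauzy_path r T\<close> is \<open>None\<close> if fewer than \<open>r\<close> Rauzy steps are defined at \<open>T\<close>.\<close>

primrec rauzy_path :: "nat \<Rightarrow> ('a::finite) iet \<Rightarrow> ('a \<times> 'a) list option" where
  "rauzy_path 0 T = Some []"
| "rauzy_path (Suc r) T =
     (case rauzy T of None \<Rightarrow> None
      | Some T' \<Rightarrow> map_option (\<lambda>\<gamma>. rauzy_arrow T # \<gamma>) (rauzy_path r T'))"

text \<open>Given by its columns: the column of the winner \<open>\<alpha>\<close> is \<open>e\<^sub>\<alpha> + e\<^sub>\<beta>\<close>.\<close>

definition arrow_mat :: "'a \<times> 'a \<Rightarrow> real ^ ('a::finite) ^ 'a" where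
  "arrow_mat = (\<lambda>(\<alpha>, \<beta>). \<chi> i j. (if j = \<alpha> then axis \<alpha> 1 + axis \<beta> 1 else axis j 1) $ i)"

lemma arrow_mat_axis:
  "arrow_mat (\<alpha>, \<beta>) *v axis \<xi> 1 = (if \<xi> = \<alpha> then axis \<alpha> 1 + axis \<beta> 1 else axis \<xi> 1)"
  by (simp add: matrix_vector_mult_basis column_def arrow_mat_def vec_eq_iff)

primrec path_mat :: "('a \<times> 'a) list \<Rightarrow> real ^ ('a::finite) ^ 'a" where
  "path_mat [] = mat 1"
| "path_mat (g # \<gamma>) = path_mat \<gamma> ** arrow_mat g"

definition positive_path :: "('a::finite \<times> 'a) list \<Rightarrow> bool" where
  "positive_path \<gamma> \<longleftrightarrow> (\<forall>i j. path_mat \<gamma> $ i $ j > 0)"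

definition positive_time :: "('a::finite) iet \<Rightarrow> nat \<Rightarrow> bool" where
  "positive_time T r \<longleftrightarrow> r \<ge> 1 \<and> (\<exists>\<gamma>. rauzy_path r T = Some \<gamma> \<and> positive_path \<gamma>)"

definition first_positive_time :: "('a::finite) iet \<Rightarrow> nat" where
  "first_positive_time T = (LEAST r. positive_time T r)"

definition pos_accel :: "('a::finite) iet \<Rightarrow> 'a iet option" where
  "pos_accel T =
     (if \<exists>r. positive_time T r then iterate_partial rauzy (first_positive_time T) T else None)"

text \<open>Meaningful only if \<open>pos_accel T \<noteq> None\<close>.\<close>

definition accel_mat :: "('a::finite) iet \<Rightarrow> real ^ 'a ^ 'a" where
  "accel_mat T = path_mat (the (rauzy_path (first_positive_time T) T))"

definition max_norm :: "real ^ ('a::finite) ^ 'a \<Rightarrow> real" where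
  "max_norm M = Max {\<bar>M $ i $ j\<bar> | i j. True}"

end

(*
  Write S for the n-th Rauzy iterate of T. It is a first return map of T. The return times r form a
  tower over each cell of S, and each singularity u_a of T lies at some height h_a < r_a above the left
  end of the cell of S with the same letter.

  Bounded acceleration implies bounded type: after a positive block the domain of S is shorter than every
  cell at the start of the block, so every singularity of S has moved and every h_a has grown by at least a
  return time. Hence all singularities T^-i(u_a) with i < N are left ends of disjoint tower floors as
  soon as N is at most the sum of the return times two blocks earlier, which bounds their distances
  below by the shortest cell; the area identity (sum of r times length equals |I|) concludes.

  Bounded type implies bounded acceleration: consider a time following a step won by the top letter. If
  the cells split into long and much shorter ones, the singularities next to long cells have small height,
  hence are well separated, and so are their preimages in long cells. This forces the long letters to be
  an initial segment of both rows, contradicting admissibility. Between two such times a single bottom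
  letter keeps winning, so all cell lengths stay comparable along the whole Rauzy orbit.
  Then every letter wins within a bounded contraction of the domain, boundedly many such windows make
  the matrix positive, and its entries are at most a ratio of cell lengths.
*)

theory Submission
  imports Defs
begin

section \<open>Positions of the intervals along one row of the datum\<close>

definition offset :: "('a::finite \<Rightarrow> nat) \<Rightarrow> ('a \<Rightarrow> real) \<Rightarrow> 'a \<Rightarrow> real" where
  "offset p lam \<alpha> = (\<Sum>\<xi> | p \<xi> < p \<alpha>. lam \<xi>)"

lemma utop_offset: "utop S = offset (ptop S) (len S)"
  and ubot_offset: "ubot S = offset (pbot S) (len S)"
  by (auto simp: utop_def ubot_def offset_def)

text \<open>Both rows are instances of this locale, so each fact about positions serves top and
  bottom.\<close>

locale row =
  fixes p :: "'a::finite \<Rightarrow> nat" and lam :: "'a \<Rightarrow> real"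
  assumes bij: "bij_betw p UNIV {1..CARD('a)}" and pos: "\<And>\<alpha>. lam \<alpha> > 0"
begin

lemma p_eq_iff [simp]: "p \<alpha> = p \<beta> \<longleftrightarrow> \<alpha> = \<beta>"
  using bij by (auto simp: bij_betw_def inj_on_def)

lemma p_ge1: "1 \<le> p \<alpha>" and p_le: "p \<alpha> \<le> CARD('a)"
  using bij by (auto simp: bij_betw_def)

lemma p_ex: "1 \<le> k \<Longrightarrow> k \<le> CARD('a) \<Longrightarrow> \<exists>\<alpha>. p \<alpha> = k"
  using bij unfolding bij_betw_def by (metis (no_types) atLeastAtMost_iff imageE)

lemma p_pred:
  assumes "p \<beta> > 1" shows "\<exists>\<alpha>. p \<beta> = Suc (p \<alpha>)"
proof -
  have "1 \<le> p \<beta> - 1" "p \<beta> - 1 \<le> CARD('a)" using p_le[of \<beta>] assms by linarith+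
  then obtain \<alpha> where "p \<alpha> = p \<beta> - 1" using p_ex by blast
  hence "p \<beta> = Suc (p \<alpha>)" using assms by linarith
  thus ?thesis ..
qed

lemma p_last: "p (last_letter p) = CARD('a)"
proof -
  obtain \<alpha> where "p \<alpha> = CARD('a)" using p_ex[of "CARD('a)"] by (auto simp: Suc_le_eq)
  thus ?thesis unfolding last_letter_def by (rule theI[where a=\<alpha>]) (metis p_eq_iff \<open>p \<alpha> = CARD('a)\<close>)
qed

lemma p_eq_card: "p \<alpha> = CARD('a) \<longleftrightarrow> \<alpha> = last_letter p"
  using p_last p_eq_iff by metis

lemma p_less_card: "\<alpha> \<noteq> last_letter p \<Longrightarrow> p \<alpha> < CARD('a)"
  using p_eq_card p_le by (metis le_neq_implies_less)

lemma image_initial: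
  assumes "k \<le> CARD('a)"
  shows "p ` {\<xi>. p \<xi> \<le> k} = {1..k}" "card {\<xi>. p \<xi> \<le> k} = k"
proof -
  show 1: "p ` {\<xi>. p \<xi> \<le> k} = {1..k}"
  proof
    show "p ` {\<xi>. p \<xi> \<le> k} \<subseteq> {1..k}" using p_ge1 by auto
    show "{1..k} \<subseteq> p ` {\<xi>. p \<xi> \<le> k}"
    proof
      fix x assume "x \<in> {1..k}"
      with p_ex[of x] assms show "x \<in> p ` {\<xi>. p \<xi> \<le> k}" by force
    qed
  qed
  have "card (p ` {\<xi>. p \<xi> \<le> k}) = card {\<xi>. p \<xi> \<le> k}"
    by (rule card_image) (auto simp: inj_on_def)
  with 1 show "card {\<xi>. p \<xi> \<le> k} = k" by simp
qed

abbreviation "off \<equiv> offset p lam"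

lemma sum_pos_mono: "X \<subseteq> Y \<Longrightarrow> sum lam X \<le> sum lam Y"
  by (rule sum_mono2) (auto simp: less_imp_le[OF pos])

text \<open>Positivity makes a proper superset strictly longer. \<open>no_gap\<close> uses this to
  recognise initial segments from lengths alone.\<close>

lemma sum_pos_eq:
  assumes "X \<subseteq> Y" "sum lam Y \<le> sum lam X" shows "X = Y"
proof (rule ccontr)
  assume "X \<noteq> Y"
  with assms obtain b where "b \<in> Y - X" by auto
  with assms have "sum lam X < sum lam Y"
    by (intro sum_strict_mono2[where b=b]) (auto simp: pos less_imp_le[OF pos])
  with assms show False by simp
qed

lemma off_end: "off \<alpha> + lam \<alpha> = (\<Sum>\<xi> | p \<xi> \<le> p \<alpha>. lam \<xi>)"
proof -
  have "{\<xi>. p \<xi> \<le> p \<alpha>} = insert \<alpha> {\<xi>. p \<xi> < p \<alpha>}" by (auto simp: le_less)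
  thus ?thesis by (simp add: offset_def)
qed

lemma off_less: "p \<alpha> < p \<beta> \<Longrightarrow> off \<alpha> + lam \<alpha> \<le> off \<beta>"
  unfolding off_end by (subst offset_def, rule sum_pos_mono) auto

lemma off_Suc: "p \<beta> = Suc (p \<alpha>) \<Longrightarrow> off \<beta> = off \<alpha> + lam \<alpha>"
  unfolding off_end by (subst offset_def, rule sum.cong) auto

lemma off_le_total: "off \<alpha> + lam \<alpha> \<le> sum lam UNIV"
  unfolding off_end by (rule sum_pos_mono) auto

lemma off_last: "off (last_letter p) + lam (last_letter p) = sum lam UNIV"
  unfolding off_end by (rule sum.cong) (auto simp: p_last p_le)

lemma off_first: "p \<alpha> = 1 \<Longrightarrow> off \<alpha> = 0"
proof -
  assume "p \<alpha> = 1"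
  hence "\<not> p \<xi> < p \<alpha>" for \<xi> using p_ge1[of \<xi>] by linarith
  hence "{\<xi>. p \<xi> < p \<alpha>} = {}" by blast
  thus ?thesis by (simp add: offset_def)
qed

lemma off_nonneg: "0 \<le> off \<alpha>"
  unfolding offset_def by (rule sum_nonneg) (auto simp: less_imp_le[OF pos])

lemma off_pos: assumes "p \<alpha> > 1" shows "\<exists>\<beta>. lam \<beta> \<le> off \<alpha>"
proof -
  obtain \<beta> where "p \<beta> = 1" using p_ex[of 1] by (auto simp: Suc_le_eq)
  with assms off_less[of \<beta> \<alpha>] off_first[of \<beta>] show ?thesis by auto
qed

lemma off_uniq:
  assumes "x \<in> {off \<alpha>..<off \<alpha> + lam \<alpha>}" "x \<in> {off \<beta>..<off \<beta> + lam \<beta>}"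
  shows "\<alpha> = \<beta>"
  using assms off_less[of \<alpha> \<beta>] off_less[of \<beta> \<alpha>] p_eq_iff[of \<alpha> \<beta>]
  by (cases "p \<alpha>" "p \<beta>" rule: linorder_cases) auto

lemma ex_argmin: assumes "(A::'a set) \<noteq> {}" shows "\<exists>\<alpha>\<in>A. \<forall>\<gamma>\<in>A. p \<alpha> \<le> p \<gamma>"
proof -
  have "Min (p ` A) \<in> p ` A" using assms by (intro Min_in) auto
  moreover have "\<forall>\<gamma>\<in>A. Min (p ` A) \<le> p \<gamma>" by simp
  ultimately show ?thesis by (metis imageE)
qed

lemma ex_argmax: assumes "(A::'a set) \<noteq> {}" shows "\<exists>\<alpha>\<in>A. \<forall>\<gamma>\<in>A. p \<gamma> \<le> p \<alpha>"
proof -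
  have "Max (p ` A) \<in> p ` A" using assms by (intro Max_in) auto
  moreover have "\<forall>\<gamma>\<in>A. p \<gamma> \<le> Max (p ` A)" by simp
  ultimately show ?thesis by (metis imageE)
qed

lemma off_cases:
  assumes "x \<in> {0..<sum lam UNIV}"
  shows "\<exists>\<alpha>. x \<in> {off \<alpha>..<off \<alpha> + lam \<alpha>}"
proof -
  let ?X = "{\<alpha>. off \<alpha> \<le> x}"
  obtain \<beta> where "p \<beta> = 1" using p_ex[of 1] by (auto simp: Suc_le_eq)
  hence "\<beta> \<in> ?X" using off_first[of \<beta>] assms by auto
  hence ne: "?X \<noteq> {}" by blast
  obtain \<alpha> where a: "\<alpha> \<in> ?X" "\<And>\<gamma>. \<gamma> \<in> ?X \<Longrightarrow> p \<gamma> \<le> p \<alpha>"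
    using ex_argmax[OF ne] by blast
  have "x < off \<alpha> + lam \<alpha>"
  proof (cases "\<alpha> = last_letter p")
    case True thus ?thesis using off_last assms by auto
  next
    case False
    then obtain \<gamma> where g: "p \<gamma> = Suc (p \<alpha>)" using p_ex[of "Suc (p \<alpha>)"] p_less_card by (auto simp: Suc_le_eq)
    with a(2)[of \<gamma>] have "\<gamma> \<notin> ?X" by auto
    thus ?thesis using off_Suc[OF g] by auto
  qed
  thus ?thesis using a by auto
qed

end

subsection \<open>One Rauzy step on a row\<close>

text \<open>The last letter lies to the left of no letter. This covers the winner's row, where the
  shortened winner is last.\<close>

lemma offset_upd_last:
  assumes "row p lam" 
  shows "offset p (lam(last_letter p := v)) \<alpha> = offset p lam \<alpha>"
proof -
  interpret row p lam by fact
  show ?thesis unfolding offset_def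
    by (rule sum.cong) (use p_le leD in \<open>fastforce simp: p_last\<close>)+
qed

context row
begin

lemma move_after_row:
  assumes "w \<noteq> last_letter p"
  shows "bij_betw (move_after (last_letter p) w p) UNIV {1..CARD('a)}"
proof -
  let ?q = "move_after (last_letter p) w p"
  have w: "p w < CARD('a)" using assms p_less_card by auto
  have "inj ?q"
  proof (rule injI)
    fix x y assume e: "?q x = ?q y"
    show "x = y" using e unfolding move_after_def by (auto split: if_splits)
  qed
  moreover have "?q ` UNIV \<subseteq> {1..CARD('a)}"
  proof -
    have "?q x \<in> {1..CARD('a)}" for x
      using w p_ge1[of x] p_le[of x] p_less_card[of x] by (auto simp: move_after_def)
    thus ?thesis by auto
  qed
  ultimately show ?thesis unfolding bij_betw_def
    by (metis card_atLeastAtMost card_image card_subset_eq diff_Suc_1 finite_atLeastAtMost)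
qed

text \<open>Nothing is inserted in front of the first letter. Hence the letters that index
  singularities stay the same along an orbit.\<close>

lemma move_after_gt1:
  assumes "CARD('a) \<ge> 2"
  shows "move_after (last_letter p) w p \<alpha> > 1 \<longleftrightarrow> p \<alpha> > 1"
  using assms p_ge1[of w] p_last p_ge1[of \<alpha>] by (auto simp: move_after_def)

text \<open>Letters beyond \<open>w\<close> gain \<open>l\<close> on their left and lose the same
  length from \<open>w\<close>, so only the loser moves: it lands on the right end of the old
  interval of \<open>w\<close>.\<close>

lemma offset_move_after:
  assumes w: "w \<noteq> last_letter p"
  defines "l \<equiv> last_letter p"
  shows "offset (move_after l w p) (lam(w := lam w - lam l)) \<alpha> =
    (if \<alpha> = l then off w + lam w - lam l else off \<alpha>)"
proof -
  let ?q = "move_after l w p" let ?m = "lam(w := lam w - lam l)"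
  have pl: "p l = CARD('a)" by (simp add: l_def p_last)
  have wl: "p w < p l" using w p_less_card by (simp add: pl)
  have lt: "\<xi> \<noteq> l \<Longrightarrow> p \<xi> < p l" for \<xi> using p_less_card[of \<xi>] pl by (simp add: l_def)
  have wnl: "w \<noteq> l" using w by (simp add: l_def)
  consider "\<alpha> = l" | "\<alpha> \<noteq> l" "p \<alpha> \<le> p w" | "\<alpha> \<noteq> l" "p \<alpha> > p w" by linarith
  thus ?thesis
  proof cases
    case 1
    have "{\<xi>. ?q \<xi> < ?q \<alpha>} = {\<xi>. p \<xi> \<le> p w}" using wl 1 by (auto simp: move_after_def)
    also have "\<dots> = insert w {\<xi>. p \<xi> < p w}" by (auto simp: le_less)
    finally have "offset ?q ?m \<alpha> = ?m w + sum ?m {\<xi>. p \<xi> < p w}"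
      unfolding offset_def by (simp del: fun_upd_apply)
    also have "sum ?m {\<xi>. p \<xi> < p w} = off w" unfolding offset_def by (rule sum.cong) auto
    finally show ?thesis unfolding 1 by (simp add: fun_upd_same del: fun_upd_apply)
  next
    case 2
    have "{\<xi>. ?q \<xi> < ?q \<alpha>} = {\<xi>. p \<xi> < p \<alpha>}" using wl 2 by (auto simp: move_after_def)
    moreover have "sum ?m {\<xi>. p \<xi> < p \<alpha>} = off \<alpha>" unfolding offset_def using 2 by (intro sum.cong) auto
    ultimately show ?thesis using 2 by (simp add: offset_def)
  next
    case 3
    have "{\<xi>. ?q \<xi> < ?q \<alpha>} = insert l {\<xi>. p \<xi> < p \<alpha>}" using wl 3 lt[of \<alpha>] by (auto simp: move_after_def split: if_splits)
    moreover have "l \<notin> {\<xi>. p \<xi> < p \<alpha>}" using lt[of \<alpha>] 3 by auto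
    ultimately have "offset ?q ?m \<alpha> = lam l + sum ?m {\<xi>. p \<xi> < p \<alpha>}" 
      using wnl by (simp add: offset_def)
    also have "{\<xi>. p \<xi> < p \<alpha>} = insert w ({\<xi>. p \<xi> < p \<alpha>} - {w})" using 3 by auto
    also have "sum ?m \<dots> = lam w - lam l + sum ?m ({\<xi>. p \<xi> < p \<alpha>} - {w})" by (subst sum.insert) auto
    also have "sum ?m ({\<xi>. p \<xi> < p \<alpha>} - {w}) = sum lam ({\<xi>. p \<xi> < p \<alpha>} - {w})" by (rule sum.cong) auto
    also have "\<dots> = off \<alpha> - lam w" unfolding offset_def using 3 by (subst sum_diff1) auto
    finally show ?thesis using 3 by (simp del: fun_upd_apply)
  qed
qed

end

subsection \<open>Interval exchange maps\<close>

definition cell :: "('a::finite) iet \<Rightarrow> 'a \<Rightarrow> real set" where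
  "cell S \<alpha> = {utop S \<alpha>..<utop S \<alpha> + len S \<alpha>}"

lemma rows:
  assumes "is_iet S" shows "row (ptop S) (len S)" "row (pbot S) (len S)"
  using assms by (auto simp: is_iet_def row_def)

lemma iet_map_cell:
  assumes "is_iet S" "x \<in> cell S \<alpha>"
  shows "iet_map S x = x - utop S \<alpha> + ubot S \<alpha>"
proof -
  interpret row "ptop S" "len S" using rows assms by auto
  have "(THE \<alpha>. x \<in> {utop S \<alpha>..<utop S \<alpha> + len S \<alpha>}) = \<alpha>"
    using assms off_uniq by (intro the_equality) (auto simp: cell_def utop_offset)
  thus ?thesis by (simp add: iet_map_def)
qed

lemma cell_uniq: "is_iet S \<Longrightarrow> x \<in> cell S \<alpha> \<Longrightarrow> x \<in> cell S \<beta> \<Longrightarrow> \<alpha> = \<beta>"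
  using row.off_uniq[OF rows(1)] by (auto simp: cell_def utop_offset)

lemma cell_ex: "is_iet S \<Longrightarrow> x \<in> iet_dom S \<Longrightarrow> \<exists>\<alpha>. x \<in> cell S \<alpha>"
  using row.off_cases[OF rows(1)] by (auto simp: cell_def utop_offset iet_dom_def total_len_def)

lemma cell_dom: "is_iet S \<Longrightarrow> x \<in> cell S \<alpha> \<Longrightarrow> x \<in> iet_dom S"
  using row.off_nonneg[OF rows(1), of S \<alpha>] row.off_le_total[OF rows(1), of S \<alpha>]
  by (auto simp: cell_def utop_offset iet_dom_def total_len_def)

lemma utop_cell: "is_iet S \<Longrightarrow> utop S \<alpha> \<in> cell S \<alpha>"
  by (simp add: cell_def is_iet_def)

lemma iet_map_bij:
  assumes "is_iet S" shows "bij_betw (iet_map S) (iet_dom S) (iet_dom S)"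
proof -
  interpret b: row "pbot S" "len S" using rows assms by auto
  have img: "iet_map S x \<in> {ubot S \<alpha>..<ubot S \<alpha> + len S \<alpha>}" if "x \<in> cell S \<alpha>" for x \<alpha>
    using iet_map_cell[OF assms that] that by (auto simp: cell_def)
  have "inj_on (iet_map S) (iet_dom S)"
  proof (rule inj_onI)
    fix x y assume h: "x \<in> iet_dom S" "y \<in> iet_dom S" "iet_map S x = iet_map S y"
    obtain \<alpha> \<beta> where c: "x \<in> cell S \<alpha>" "y \<in> cell S \<beta>" using cell_ex[OF assms] h by meson
    have "\<alpha> = \<beta>" using img[OF c(1)] img[OF c(2)] h(3) b.off_uniq by (auto simp: ubot_offset)
    thus "x = y" using c h(3) iet_map_cell[OF assms c(1)] iet_map_cell[OF assms c(2)] by simp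
  qed
  moreover have "iet_map S ` iet_dom S = iet_dom S"
  proof (intro equalityI subsetI)
    fix y assume "y \<in> iet_map S ` iet_dom S"
    then obtain x \<alpha> where "y = iet_map S x" "x \<in> cell S \<alpha>" using cell_ex[OF assms] by blast
    with img[of x \<alpha>] b.off_nonneg[of \<alpha>] b.off_le_total[of \<alpha>] show "y \<in> iet_dom S"
      by (auto simp: iet_dom_def total_len_def ubot_offset)
  next
    fix y assume "y \<in> iet_dom S"
    then obtain \<alpha> where a: "y \<in> {ubot S \<alpha>..<ubot S \<alpha> + len S \<alpha>}"
      using b.off_cases[of y] by (auto simp: iet_dom_def total_len_def ubot_offset)
    let ?x = "y - ubot S \<alpha> + utop S \<alpha>"
    have x: "?x \<in> cell S \<alpha>" using a by (auto simp: cell_def)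
    have "iet_map S ?x = y" using iet_map_cell[OF assms x] by simp
    thus "y \<in> iet_map S ` iet_dom S" using cell_dom[OF assms x] by (metis imageI)
  qed
  ultimately show ?thesis by (simp add: bij_betw_def)
qed

lemma iet_map_dom: "is_iet S \<Longrightarrow> x \<in> iet_dom S \<Longrightarrow> iet_map S x \<in> iet_dom S"
  using iet_map_bij by (auto simp: bij_betw_def)

lemma iet_map_pow_dom: "is_iet S \<Longrightarrow> x \<in> iet_dom S \<Longrightarrow> (iet_map S ^^ i) x \<in> iet_dom S"
  by (induction i) (auto intro: iet_map_dom)

lemma iet_map_pow_inj:
  "is_iet S \<Longrightarrow> x \<in> iet_dom S \<Longrightarrow> y \<in> iet_dom S \<Longrightarrow> (iet_map S ^^ i) x = (iet_map S ^^ i) y \<Longrightarrow> x = y"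
proof (induction i)
  case (Suc i)
  then show ?case using iet_map_bij[of S] iet_map_pow_dom[of S] 
    by (auto simp: bij_betw_def inj_on_def)
qed simp

text \<open>Lets singularities, defined by backward iterates, be recognised by forward
  iteration.\<close>

lemma inv_pow_eq:
  assumes "is_iet S" "x \<in> iet_dom S" "(iet_map S ^^ i) x = y"
  shows "(inv_into (iet_dom S) (iet_map S) ^^ i) y = x"
  using assms(2,3)
proof (induction i arbitrary: y)
  case (Suc i)
  have "y = iet_map S ((iet_map S ^^ i) x)" using Suc.prems by simp
  hence "inv_into (iet_dom S) (iet_map S) y = (iet_map S ^^ i) x"
    using iet_map_bij[OF assms(1)] iet_map_pow_dom[OF assms(1) Suc.prems(1)]
    by (simp add: bij_betw_def inv_into_f_f)
  with Suc.IH[OF Suc.prems(1)] show ?case by (simp del: funpow.simps add: funpow_Suc_right)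
qed simp

subsection \<open>The Rauzy step\<close>

abbreviation "rz S \<equiv> the (rauzy S)"

definition topwin :: "('a::finite) iet \<Rightarrow> bool" where
  "topwin S \<longleftrightarrow> len S (last_letter (ptop S)) > len S (last_letter (pbot S))"

abbreviation "winner S \<equiv> fst (rauzy_arrow S)"
abbreviation "loser S \<equiv> snd (rauzy_arrow S)"

locale adm_iet =
  fixes S :: "('a::finite) iet"
  assumes iet: "is_iet S" and adm: "admissible S" and card2: "CARD('a) \<ge> 2"
begin

abbreviation "a \<equiv> last_letter (ptop S)"
abbreviation "b \<equiv> last_letter (pbot S)"

sublocale t: row "ptop S" "len S" using rows iet by auto
sublocale b: row "pbot S" "len S" using rows iet by auto

text \<open>If one letter were last in both rows, the remaining letters would violate
  admissibility.\<close>

lemma a_neq_b: "a \<noteq> b"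
proof
  assume ab: "a = b"
  let ?X = "UNIV - {a}"
  have card: "card ?X = CARD('a) - 1" by (simp add: card_Diff_singleton)
  have X: "?X = {\<xi>. q \<xi> \<le> CARD('a) - 1}" if "row q (len S)" "last_letter q = a" for q
  proof -
    interpret q: row q "len S" by fact
    have "(\<xi> \<noteq> a) = (q \<xi> \<le> CARD('a) - 1)" for \<xi>
    proof
      assume "\<xi> \<noteq> a" thus "q \<xi> \<le> CARD('a) - 1" using q.p_less_card[of \<xi>] that(2) by simp
    next
      assume "q \<xi> \<le> CARD('a) - 1" thus "\<xi> \<noteq> a" using q.p_last card2 that(2) by auto
    qed
    thus ?thesis by blast
  qed
  have t: "?X = {\<xi>. ptop S \<xi> \<le> CARD('a) - 1}" using X[OF t.row_axioms] by simp
  have b: "?X = {\<xi>. pbot S \<xi> \<le> CARD('a) - 1}" using X[OF b.row_axioms] ab by simp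
  have "ptop S ` ?X = {1..CARD('a) - 1}" by (subst t, rule t.image_initial(1)) simp
  hence "ptop S ` ?X = {1..card ?X}" by (simp only: card)
  moreover have "pbot S ` ?X = {1..CARD('a) - 1}" by (subst b, rule b.image_initial(1)) simp
  hence "pbot S ` ?X = {1..card ?X}" by (simp only: card)
  moreover have "?X \<noteq> {}"
  proof
    assume "?X = {}"
    hence "card ?X = 0" by (simp only: card.empty)
    with card card2 show False by linarith
  qed
  moreover have "?X \<noteq> UNIV" by blast
  ultimately show False using adm unfolding admissible_def by (elim notE, intro exI[of _ ?X] conjI)
qed

lemma utop_a: "utop S a + len S a = total_len S"
  using t.off_last by (simp add: utop_offset total_len_def)

lemma ubot_b: "ubot S b + len S b = total_len S"
  using b.off_last by (simp add: ubot_offset total_len_def)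

lemma a_gt1: "ptop S a > 1" using t.p_last card2 by simp

end

locale rauzy_step = adm_iet +
  assumes defd: "rauzy S \<noteq> None"
begin

lemma rz_top:
  assumes "topwin S"
  shows "rz S = S\<lparr>pbot := move_after b a (pbot S), len := (len S)(a := len S a - len S b)\<rparr>"
    "rauzy_arrow S = (a, b)"
  using assms by (auto simp: topwin_def rauzy_def rauzy_arrow_def Let_def)

lemma rz_bot:
  assumes "\<not> topwin S"
  shows "rz S = S\<lparr>ptop := move_after a b (ptop S), len := (len S)(b := len S b - len S a)\<rparr>"
    "rauzy_arrow S = (b, a)" "len S b > len S a"
  using assms defd by (auto simp: topwin_def rauzy_def rauzy_arrow_def Let_def split: if_splits)

lemma len_rz: "len (rz S) = (len S)(winner S := len S (winner S) - len S (loser S))"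
  by (cases "topwin S") (simp_all add: rz_top rz_bot)

lemma len_loser_less: "len S (loser S) < len S (winner S)"
proof (cases "topwin S")
  case True
  show ?thesis unfolding rz_top(2)[OF True] fst_conv snd_conv using True[unfolded topwin_def] .
next
  case False
  show ?thesis unfolding rz_bot(2)[OF False] fst_conv snd_conv using rz_bot(3)[OF False] .
qed

lemma winner_neq_loser: "winner S \<noteq> loser S"
  using len_loser_less by (metis less_irrefl)

lemma len_rz_pos: "len (rz S) \<alpha> > 0"
  using len_loser_less t.pos by (simp add: len_rz)

lemma len_rz_le: "len (rz S) \<alpha> \<le> len S \<alpha>"
  using t.pos[of "loser S"] by (simp add: len_rz less_imp_le)

lemma iet_rz: "is_iet (rz S)"
  using iet len_rz_pos t.move_after_row[of b] b.move_after_row[of a] a_neq_b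
  by (cases "topwin S") (auto simp: is_iet_def rz_top rz_bot simp del: fun_upd_apply)

lemma total_rz: "total_len (rz S) = total_len S - len S (loser S)"
proof -
  have "total_len (rz S) = len (rz S) (winner S) + sum (len (rz S)) (UNIV - {winner S})"
    unfolding total_len_def by (rule sum.remove) auto
  also have "sum (len (rz S)) (UNIV - {winner S}) = sum (len S) (UNIV - {winner S})"
    by (rule sum.cong) (auto simp: len_rz)
  also have "\<dots> = total_len S - len S (winner S)"
    unfolding total_len_def by (simp add: sum_diff1)
  finally show ?thesis by (simp add: len_rz)
qed

text \<open>An initial segment of the new row that avoids \<open>w\<close> lies to the left of
  \<open>w\<close>, where the move changes nothing.\<close>

lemma initial_move_after:
  assumes "row p (len S)" "w \<noteq> last_letter p" "move_after (last_letter p) w p ` X = {1..card X}"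
    "w \<notin> X"
  shows "p ` X = {1..card X}"
proof -
  interpret row p "len S" by fact
  let ?l = "last_letter p" let ?q = "move_after ?l w p"
  interpret q: row ?q "len S" using move_after_row[OF assms(2)] pos by (simp add: row_def)
  have qX: "\<xi> \<in> X \<longleftrightarrow> ?q \<xi> \<le> card X" for \<xi>
  proof
    assume "?q \<xi> \<le> card X"
    hence "?q \<xi> \<in> ?q ` X" unfolding assms(3) using q.p_ge1 by simp
    thus "\<xi> \<in> X" by (auto simp: q.p_eq_iff)
  qed (use assms(3) in auto)
  have wl: "p w < p ?l" using p_less_card[OF assms(2)] by (simp add: p_last)
  have "card X < ?q w" using qX[of w] assms(4) by simp
  hence cw: "card X < p w" using assms(2) by (simp add: move_after_def)
  hence "?q \<xi> = p \<xi>" if "\<xi> \<in> X" for \<xi> using qX[of \<xi>] that unfolding move_after_def by (auto split: if_splits)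
  hence "p ` X = ?q ` X" by (intro image_cong) auto
  thus ?thesis using assms(3) by simp
qed

lemma last_notin_initial:
  assumes "row p (len S)" "p ` X = {1..card X}" "X \<noteq> UNIV"
  shows "last_letter p \<notin> X"
proof
  interpret row p "len S" by fact
  assume "last_letter p \<in> X"
  hence "CARD('a) \<in> p ` X" using p_last by (metis imageI)
  hence "CARD('a) \<le> card X" by (simp add: assms)
  with assms(3) show False by (metis card_seteq finite subset_UNIV)
qed

text \<open>The winner is last in the unchanged row, so a proper common initial segment avoids it
  and was already a common initial segment before the step.\<close>

lemma admissible_rz: "admissible (rz S)"
  unfolding admissible_def
proof (intro notI, elim exE conjE)
  fix X assume X: "X \<noteq> {}" "X \<noteq> UNIV" and h: "ptop (rz S) ` X = {1..card X}" "pbot (rz S) ` X = {1..card X}"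
  have "ptop S ` X = {1..card X} \<and> pbot S ` X = {1..card X}"
  proof (cases "topwin S")
    case True
    with h have p: "ptop S ` X = {1..card X}" "move_after b a (pbot S) ` X = {1..card X}" by (auto simp: rz_top)
    from last_notin_initial[OF t.row_axioms p(1) X(2)] show ?thesis
      using initial_move_after[OF b.row_axioms _ p(2)] a_neq_b p by blast
  next
    case False
    with h have p: "pbot S ` X = {1..card X}" "move_after a b (ptop S) ` X = {1..card X}" by (auto simp: rz_bot)
    from last_notin_initial[OF b.row_axioms p(1) X(2)] show ?thesis
      using initial_move_after[OF t.row_axioms _ p(2)] a_neq_b p by metis
  qed
  thus False using adm X unfolding admissible_def by blast
qed

lemma utop_rz: "utop (rz S) \<alpha> = (if \<not> topwin S \<and> \<alpha> = a then utop S b + len S b - len S a else utop S \<alpha>)"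
proof (cases "topwin S")
  case True thus ?thesis by (simp add: rz_top utop_offset offset_upd_last[OF t.row_axioms])
next
  case False thus ?thesis using a_neq_b t.offset_move_after[of b \<alpha>] by (simp add: rz_bot utop_offset del: fun_upd_apply)
qed

lemma ubot_rz: "ubot (rz S) \<alpha> = (if topwin S \<and> \<alpha> = b then ubot S a + len S a - len S b else ubot S \<alpha>)"
proof (cases "topwin S")
  case False thus ?thesis by (simp add: rz_bot ubot_offset offset_upd_last[OF b.row_axioms])
next
  case True thus ?thesis using a_neq_b b.offset_move_after[of a \<alpha>] by (simp add: rz_top ubot_offset del: fun_upd_apply)
qed

lemma gt1_rz: "ptop (rz S) \<alpha> > 1 \<longleftrightarrow> ptop S \<alpha> > 1"
  using t.move_after_gt1[OF card2] by (cases "topwin S") (auto simp: rz_top rz_bot)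

lemma cell_rz:
  assumes "x \<in> cell (rz S) \<xi>" "\<xi> \<noteq> loser S"
  shows "x \<in> cell S \<xi>" "iet_map (rz S) x = iet_map S x"
proof -
  have 1: "utop (rz S) \<xi> = utop S \<xi>" "ubot (rz S) \<xi> = ubot S \<xi>" 
    using assms(2) by (cases "topwin S"; auto simp: utop_rz ubot_rz rz_top(2) rz_bot(2))+
  show "x \<in> cell S \<xi>" using assms(1) len_rz_le[of \<xi>] 1 by (auto simp: cell_def)
  with 1 show "iet_map (rz S) x = iet_map S x" using iet_map_cell[OF iet] iet_map_cell[OF iet_rz assms(1)] by simp
qed

text \<open>The step is a first return map. Whichever letter wins, the loser's points are those that
  leave the shortened domain: they pass through cell \<open>b\<close> into the removed right end,
  inside cell \<open>a\<close>, and return one application later.\<close>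

lemma cell_rz_loser:
  assumes "x \<in> cell (rz S) (loser S)"
  shows "x \<in> cell S b" "iet_map S x = x - utop S b + ubot S b" "iet_map S x \<in> cell S a" "iet_map S x \<notin> iet_dom (rz S)"
    "iet_map (rz S) x = iet_map S (iet_map S x)"
proof -
  have l: "len (rz S) (loser S) = len S (loser S)" using winner_neq_loser by (simp add: len_rz)
  show 1: "x \<in> cell S b"
    using assms t.pos[of a] rz_bot(3) unfolding cell_def l
    by (cases "topwin S") (auto simp: utop_rz rz_top(2) rz_bot(2))
  show 2: "iet_map S x = x - utop S b + ubot S b" by (rule iet_map_cell[OF iet 1])
  show 3: "iet_map S x \<in> cell S a"
    unfolding 2 using assms utop_a ubot_b rz_bot(3) unfolding cell_def l
    by (cases "topwin S") (auto simp: utop_rz rz_top(2) rz_bot(2) topwin_def)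
  show "iet_map S x \<notin> iet_dom (rz S)"
    unfolding 2 iet_dom_def total_rz using assms utop_a ubot_b rz_bot(3) unfolding cell_def l
    by (cases "topwin S") (auto simp: utop_rz rz_top(2) rz_bot(2) topwin_def)
  show "iet_map (rz S) x = iet_map S (iet_map S x)"
    unfolding iet_map_cell[OF iet 3] iet_map_cell[OF iet_rz assms] unfolding 2
    using utop_a ubot_b a_neq_b by (cases "topwin S") (auto simp: utop_rz ubot_rz rz_top(2) rz_bot(2))
qed

text \<open>After a bottom win the new left end of \<open>a\<close> is a preimage of the old one;
  this is the only way in which a singularity gains height.\<close>

lemma utop_rz_loser:
  assumes "\<not> topwin S"
  shows "utop (rz S) a \<in> cell S b" "iet_map S (utop (rz S) a) = utop S a"
proof -
  have l: "loser S = a" by (simp add: assms rz_bot)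
  have 1: "utop (rz S) a \<in> cell (rz S) (loser S)" unfolding l by (rule utop_cell[OF iet_rz])
  from cell_rz_loser(1,2)[OF 1] show "utop (rz S) a \<in> cell S b" "iet_map S (utop (rz S) a) = utop S a"
    using utop_a ubot_b by (auto simp: utop_rz assms)
qed

lemma dom_rz: "iet_dom (rz S) \<subseteq> iet_dom S"
  using t.pos[of "loser S"] by (auto simp: iet_dom_def total_rz)

end

subsection \<open>Return times and heights of singularities\<close>

text \<open>The loser's points climb the towers of both compared letters before they return.\<close>

definition rt_step :: "('a::finite) iet \<Rightarrow> ('a \<Rightarrow> nat) \<Rightarrow> 'a \<Rightarrow> nat" where
  "rt_step S r = r(loser S := r (loser S) + r (winner S))"

text \<open>A height changes only when the left end moves, which requires a bottom win; the new left
  end lies one tower of the winner further down.\<close>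

definition ht_step :: "('a::finite) iet \<Rightarrow> ('a \<Rightarrow> nat) \<Rightarrow> ('a \<Rightarrow> nat) \<Rightarrow> 'a \<Rightarrow> nat" where
  "ht_step S r h = (if topwin S then h else h(loser S := h (loser S) + r (winner S)))"

text \<open>A Kakutani tower: \<open>S\<close> is the first return map of \<open>T\<close>, floors
  are translates of cells, and singularities of \<open>T\<close> are left ends of floors. The last
  clause is Kac's formula.\<close>

definition tower :: "('a::finite) iet \<Rightarrow> 'a iet \<Rightarrow> ('a \<Rightarrow> nat) \<Rightarrow> ('a \<Rightarrow> nat) \<Rightarrow> bool" where
  "tower T S r h \<longleftrightarrow>
     (\<forall>\<alpha>. \<forall>x\<in>cell S \<alpha>. (iet_map T ^^ r \<alpha>) x = iet_map S x) \<and>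
     (\<forall>\<alpha>. \<forall>x\<in>cell S \<alpha>. \<forall>j. 0 < j \<and> j < r \<alpha> \<longrightarrow> (iet_map T ^^ j) x \<notin> iet_dom S) \<and>
     (\<forall>\<alpha>. \<forall>x\<in>cell S \<alpha>. \<forall>y\<in>cell S \<alpha>. \<forall>j<r \<alpha>. (iet_map T ^^ j) x - (iet_map T ^^ j) y = x - y) \<and>
     (\<forall>\<alpha>. 1 \<le> r \<alpha>) \<and>
     (\<forall>\<alpha>. ptop S \<alpha> > 1 \<longrightarrow> h \<alpha> < r \<alpha> \<and> (iet_map T ^^ h \<alpha>) (utop S \<alpha>) = utop T \<alpha>) \<and>
     iet_dom S \<subseteq> iet_dom T \<and> (\<forall>\<alpha>. ptop S \<alpha> > 1 \<longleftrightarrow> ptop T \<alpha> > 1) \<and>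
     (\<Sum>\<alpha>\<in>UNIV. real (r \<alpha>) * len S \<alpha>) = total_len T"

lemma towerD:
  assumes "tower T S r h"
  shows "x \<in> cell S \<alpha> \<Longrightarrow> (iet_map T ^^ r \<alpha>) x = iet_map S x"
    "x \<in> cell S \<alpha> \<Longrightarrow> 0 < j \<Longrightarrow> j < r \<alpha> \<Longrightarrow> (iet_map T ^^ j) x \<notin> iet_dom S"
    "x \<in> cell S \<alpha> \<Longrightarrow> y \<in> cell S \<alpha> \<Longrightarrow> j < r \<alpha> \<Longrightarrow> (iet_map T ^^ j) x - (iet_map T ^^ j) y = x - y"
    "1 \<le> r \<alpha>"
    "ptop S \<alpha> > 1 \<Longrightarrow> h \<alpha> < r \<alpha>"
    "ptop S \<alpha> > 1 \<Longrightarrow> (iet_map T ^^ h \<alpha>) (utop S \<alpha>) = utop T \<alpha>"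
    "iet_dom S \<subseteq> iet_dom T" "ptop S \<alpha> > 1 \<longleftrightarrow> ptop T \<alpha> > 1"
    "(\<Sum>\<alpha>\<in>UNIV. real (r \<alpha>) * len S \<alpha>) = total_len T"
  using assms unfolding tower_def by blast+

lemma tower_refl: "is_iet T \<Longrightarrow> tower T T (\<lambda>_. 1) (\<lambda>_. 0)"
  by (auto simp: tower_def total_len_def)

lemma (in rauzy_step) tower_step:
  assumes "tower T S r h"
  shows "tower T (rz S) (rt_step S r) (ht_step S r h)"
proof -
  let ?f = "iet_map T" let ?r = "rt_step S r" let ?h = "ht_step S r h" let ?l = "loser S"
  note D = towerD[OF assms]
  have rl: "?r ?l = r b + r a" by (cases "topwin S") (auto simp: rt_step_def rz_top(2) rz_bot(2))
  have rn: "\<alpha> \<noteq> ?l \<Longrightarrow> ?r \<alpha> = r \<alpha>" for \<alpha> by (simp add: rt_step_def)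
  \<comment> \<open>The loser's new tower is the tower over \<open>b\<close> with the tower over
    \<open>a\<close> stacked on top; heights from \<open>r b\<close> on belong to the
    latter.\<close>
  have split: "(?f ^^ j) x = (?f ^^ (j - r b)) (iet_map S x)" if "x \<in> cell S b" "r b \<le> j" for x j
  proof -
    have "(?f ^^ (j - r b + r b)) x = (?f ^^ (j - r b)) ((?f ^^ r b) x)" by (simp only: funpow_add o_apply)
    thus ?thesis using that D(1) by simp
  qed
  have "(?f ^^ ?r \<alpha>) x = iet_map (rz S) x" if x: "x \<in> cell (rz S) \<alpha>" for \<alpha> x
  proof (cases "\<alpha> = ?l")
    case True
    note c = cell_rz_loser[OF x[unfolded True]]
    show ?thesis using split[OF c(1), of "?r ?l"] D(1)[OF c(3)] c(5) by (simp add: True rl)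
  next
    case False with cell_rz[OF x False] D(1) show ?thesis by (simp add: rn)
  qed
  moreover have "(?f ^^ j) x \<notin> iet_dom (rz S)" if x: "x \<in> cell (rz S) \<alpha>" and j: "0 < j" "j < ?r \<alpha>" for \<alpha> x j
  proof (cases "\<alpha> = ?l")
    case True
    note c = cell_rz_loser[OF x[unfolded True]]
    \<comment> \<open>At the junction \<open>j = r b\<close> the orbit does meet the old domain, but
      in the part that is cut off.\<close>
    consider "j < r b" | "j = r b" | "j > r b" by linarith
    thus ?thesis
    proof cases
      case 1 with D(2)[OF c(1) j(1)] dom_rz show ?thesis by auto
    next
      case 2 with D(1)[OF c(1)] c(4) show ?thesis by simp
    next
      case 3
      hence "(?f ^^ (j - r b)) (iet_map S x) \<notin> iet_dom S" using D(2)[OF c(3), of "j - r b"] j(2) by (simp add: True rl)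
      thus ?thesis using split[OF c(1), of j] dom_rz 3 by auto
    qed
  next
    case False with cell_rz[OF x False] D(2) j dom_rz show ?thesis by (auto simp: rn)
  qed
  moreover have "(?f ^^ j) x - (?f ^^ j) y = x - y" if x: "x \<in> cell (rz S) \<alpha>" and y: "y \<in> cell (rz S) \<alpha>" and j: "j < ?r \<alpha>" for \<alpha> x y j
  proof (cases "\<alpha> = ?l")
    case True
    note c = cell_rz_loser[OF x[unfolded True]]
    note d = cell_rz_loser[OF y[unfolded True]]
    show ?thesis
    proof (cases "j < r b")
      case True with D(3)[OF c(1) d(1)] show ?thesis by simp
    next
      case False
      with j have "j - r b < r a" by (simp add: True rl)
      from D(3)[OF c(3) d(3) this] False show ?thesis using split[OF c(1), of j] split[OF d(1), of j] c(2) d(2) by simp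
    qed
  next
    case False with cell_rz[OF x False] cell_rz[OF y False] D(3) j show ?thesis by (simp add: rn)
  qed
  moreover have "1 \<le> ?r \<alpha>" for \<alpha> using D(4)[of \<alpha>] by (auto simp: rt_step_def)
  moreover have "?h \<alpha> < ?r \<alpha> \<and> (?f ^^ ?h \<alpha>) (utop (rz S) \<alpha>) = utop T \<alpha>" if "ptop (rz S) \<alpha> > 1" for \<alpha>
  proof (cases "topwin S \<or> \<alpha> \<noteq> a")
    case True
    have p: "ptop S \<alpha> > 1" using that gt1_rz by simp
    have "?h \<alpha> = h \<alpha>" "utop (rz S) \<alpha> = utop S \<alpha>" using True by (auto simp: ht_step_def utop_rz rz_bot(2))
    moreover have "r \<alpha> \<le> ?r \<alpha>" by (simp add: rt_step_def)
    ultimately show ?thesis using D(5,6)[OF p] by simp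
  next
    case False
    hence n: "\<not> topwin S" "\<alpha> = a" by auto
    have l: "?l = a" "winner S = b" by (auto simp: n rz_bot(2))
    have "?h a = h a + r b" by (simp add: ht_step_def n l)
    moreover have "h a < r a" using D(5)[OF a_gt1] .
    moreover have "(?f ^^ (h a + r b)) (utop (rz S) a) = utop T a"
      using split[OF utop_rz_loser(1)[OF n(1)], of "h a + r b"] utop_rz_loser(2)[OF n(1)] D(6)[OF a_gt1] by simp
    ultimately show ?thesis using rl by (simp add: n l)
  qed
  moreover have "iet_dom (rz S) \<subseteq> iet_dom T" using dom_rz D(7) by blast
  moreover have "ptop (rz S) \<alpha> > 1 \<longleftrightarrow> ptop T \<alpha> > 1" for \<alpha> using gt1_rz D(8) by simp
  moreover have "(\<Sum>\<alpha>\<in>UNIV. real (?r \<alpha>) * len (rz S) \<alpha>) = total_len T"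
  proof -
    let ?w = "winner S"
    \<comment> \<open>Only two terms change: the loser gains \<open>r ?w\<close> floors of its own
      length, which is exactly the length lost by the winner on its \<open>r ?w\<close>
      floors.\<close>
    have U: "(UNIV::'a set) = insert ?l (insert ?w (UNIV - {?l, ?w}))" by auto
    have e: "(\<Sum>\<alpha>\<in>UNIV. g \<alpha>) = g ?l + g ?w + (\<Sum>\<alpha>\<in>UNIV - {?l, ?w}. g \<alpha>)" for g :: "'a \<Rightarrow> real"
      using winner_neq_loser by (subst U) (simp add: add.assoc)
    have "(\<Sum>\<alpha>\<in>UNIV - {?l, ?w}. real (?r \<alpha>) * len (rz S) \<alpha>) = (\<Sum>\<alpha>\<in>UNIV - {?l, ?w}. real (r \<alpha>) * len S \<alpha>)"
      by (rule sum.cong) (auto simp: rt_step_def len_rz)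
    thus ?thesis using D(9) winner_neq_loser unfolding e by (simp add: rt_step_def len_rz algebra_simps)
  qed
  ultimately show ?thesis unfolding tower_def by blast
qed

text \<open>\<open>h \<alpha>\<close> is the height at which the singularity sits above the left end of \<open>\<alpha>\<close>. It is dominated
  by the height of the tower on its left, except above the last bottom letter.\<close>

definition heights_le :: "('a::finite) iet \<Rightarrow> ('a \<Rightarrow> nat) \<Rightarrow> ('a \<Rightarrow> nat) \<Rightarrow> bool" where
  "heights_le S r h \<longleftrightarrow> (\<forall>\<beta> \<gamma>. ptop S \<gamma> = Suc (ptop S \<beta>) \<longrightarrow>
     h \<gamma> \<le> r \<beta> + (if \<beta> = last_letter (pbot S) then r (last_letter (ptop S)) else 0))"

text \<open>The bound without the exceptional term. It holds at time 0 and after every top win, the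
  times at which lengths are compared directly.\<close>

definition strong_heights_le :: "('a::finite) iet \<Rightarrow> ('a \<Rightarrow> nat) \<Rightarrow> ('a \<Rightarrow> nat) \<Rightarrow> bool" where
  "strong_heights_le S r h \<longleftrightarrow> (\<forall>\<beta> \<gamma>. ptop S \<gamma> = Suc (ptop S \<beta>) \<longrightarrow> h \<gamma> \<le> r \<beta>)"

lemma strong_imp_heights_le: "strong_heights_le S r h \<Longrightarrow> heights_le S r h"
  by (auto simp: heights_le_def strong_heights_le_def intro: trans_le_add1)

context rauzy_step
begin

text \<open>Heights and top row stay fixed while the tower over \<open>b\<close> grows by that over
  \<open>a\<close>, which absorbs the exceptional term.\<close>

lemma heights_step_top:
  assumes "heights_le S r h" "topwin S"
  shows "strong_heights_le (rz S) (rt_step S r) (ht_step S r h)"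
  unfolding strong_heights_le_def
proof (intro allI impI)
  fix \<beta> \<gamma> assume "ptop (rz S) \<gamma> = Suc (ptop (rz S) \<beta>)"
  hence "ptop S \<gamma> = Suc (ptop S \<beta>)" by (simp add: rz_top assms)
  with assms(1) show "ht_step S r h \<gamma> \<le> rt_step S r \<beta>"
    by (auto simp: heights_le_def ht_step_def rt_step_def assms(2) rz_top(2)[OF assms(2)] split: if_splits)
qed

text \<open>Now \<open>a\<close> follows \<open>b\<close>, and its old height is bounded by the
  tower of the new last top letter, the new exceptional term. The letter that used to follow
  \<open>b\<close> now follows \<open>a\<close>, whose tower equals the old exceptional
  bound.\<close>

lemma heights_step_bot:
  assumes J: "heights_le S r h" and bw: "\<not> topwin S" and ha: "h a < r a"
  shows "heights_le (rz S) (rt_step S r) (ht_step S r h)"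
  unfolding heights_le_def
proof (intro allI impI)
  fix \<beta> \<gamma>
  let ?p = "ptop S" and ?q = "ptop (rz S)" and ?r = "rt_step S r" and ?h = "ht_step S r h"
  assume s: "?q \<gamma> = Suc (?q \<beta>)"
  have arr: "winner S = b" "loser S = a" by (auto simp: rz_bot bw)
  have q: "?q = move_after a b ?p" using rz_bot(1)[OF bw] by simp
  have pb: "pbot (rz S) = pbot S" using rz_bot(1)[OF bw] by simp
  interpret q: row ?q "len (rz S)" using rows iet_rz by auto
  have J': "?p \<gamma>' = Suc (?p \<beta>') \<Longrightarrow> h \<gamma>' \<le> r \<beta>' + (if \<beta>' = b then r a else 0)" for \<beta>' \<gamma>'
    using J unfolding heights_le_def by blast
  have bl: "?p b < CARD('a)" using t.p_less_card a_neq_b by metis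
  have r': "?r a = r a + r b" "\<xi> \<noteq> a \<Longrightarrow> ?r \<xi> = r \<xi>" for \<xi> by (simp_all add: rt_step_def arr)
  have h': "?h a = h a + r b" "\<xi> \<noteq> a \<Longrightarrow> ?h \<xi> = h \<xi>" for \<xi> by (simp_all add: ht_step_def arr bw)
  have qa: "?q a = Suc (?p b)" and qb: "?q b = ?p b" using a_neq_b by (auto simp: q move_after_def)
  have qn: "?q \<xi> = (if ?p \<xi> > ?p b then Suc (?p \<xi>) else ?p \<xi>)" if "\<xi> \<noteq> a" for \<xi>
    using that by (simp add: q move_after_def)
  consider "\<beta> = b" | "\<beta> = a" | "\<beta> \<noteq> a" "\<beta> \<noteq> b" by blast
  thus "?h \<gamma> \<le> ?r \<beta> + (if \<beta> = last_letter (pbot (rz S)) then ?r (last_letter ?q) else 0)"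
  proof cases
    case 1
    hence "\<gamma> = a" using s qa qb by (metis q.p_eq_iff)
    obtain c where pa: "?p a = Suc (?p c)" using t.p_pred[OF a_gt1] by blast
    hence c: "?p c = CARD('a) - 1" using t.p_last by simp
    \<comment> \<open>If \<open>a\<close> already followed \<open>b\<close>, the top row is
      unchanged and \<open>a\<close> stays last; otherwise its old left neighbour \<open>c\<close>
      becomes last.\<close>
    have "h a \<le> ?r (last_letter ?q)"
    proof (cases "c = b")
      case True
      hence "?q a = CARD('a)" using qa pa t.p_last by simp
      hence "last_letter ?q = a" using q.p_eq_card by simp
      thus ?thesis using ha r' by simp
    next
      case False
      have "c \<noteq> a" using pa by auto
      moreover have "?p c \<noteq> ?p b" using False by simp
      hence "?p c > ?p b" using bl c by linarith
      ultimately have "?q c = CARD('a)" using qn[of c] pa t.p_last by simp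
      hence "last_letter ?q = c" using q.p_eq_card by simp
      thus ?thesis using J'[OF pa] False r' \<open>c \<noteq> a\<close> by simp
    qed
    thus ?thesis using a_neq_b by (simp add: pb 1 \<open>\<gamma> = a\<close> h' r')
  next
    case 2
    hence g: "\<gamma> \<noteq> a" using s by auto
    have "?p \<gamma> = Suc (?p b)" using s 2 qa qn[OF g] by (auto split: if_splits)
    from J'[OF this] show ?thesis by (simp add: 2 r' h' g)
  next
    case 3
    have pbb: "?p \<beta> \<noteq> ?p b" using 3 by simp
    have g: "\<gamma> \<noteq> a" using s qa qn[OF 3(1)] pbb by (auto split: if_splits)
    have "?p \<gamma> = Suc (?p \<beta>)" using s qn[OF g] qn[OF 3(1)] pbb by (auto split: if_splits)
    from J'[OF this] show ?thesis using 3 by (simp add: r' h' g)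
  qed
qed

lemma utop_rz_changed:
  assumes "utop (rz S) \<beta> \<noteq> utop S \<beta>"
  shows "ht_step S r h \<beta> = h \<beta> + r (winner S)"
proof -
  have "\<not> topwin S" "\<beta> = a" using assms by (auto simp: utop_rz split: if_splits)
  thus ?thesis by (simp add: ht_step_def rz_bot(2))
qed

text \<open>The winner is still last in its row, so it is compared again at the next step.\<close>

lemma winner_persists:
  assumes "rauzy_step (rz S)"
  shows "winner (rz S) = winner S \<or> loser (rz S) = winner S"
proof -
  interpret s: rauzy_step "rz S" by fact
  have "winner S = s.a \<or> winner S = s.b"
    by (cases "topwin S") (simp_all add: rz_top rz_bot)
  thus ?thesis using s.rz_top(2) s.rz_bot(2) by (cases "topwin (rz S)") auto
qed

end

subsection \<open>Rauzy orbits\<close>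

text \<open>Total because of \<open>the\<close>; the values mean something only while the steps are
  defined.\<close>

primrec orb :: "('a::finite) iet \<Rightarrow> nat \<Rightarrow> 'a iet" where
  "orb T 0 = T"
| "orb T (Suc n) = rz (orb T n)"

primrec rtime :: "('a::finite) iet \<Rightarrow> nat \<Rightarrow> 'a \<Rightarrow> nat" where
  "rtime T 0 = (\<lambda>_. 1)"
| "rtime T (Suc n) = rt_step (orb T n) (rtime T n)"

primrec htime :: "('a::finite) iet \<Rightarrow> nat \<Rightarrow> 'a \<Rightarrow> nat" where
  "htime T 0 = (\<lambda>_. 0)"
| "htime T (Suc n) = ht_step (orb T n) (rtime T n) (htime T n)"

abbreviation arrows :: "('a::finite) iet \<Rightarrow> nat \<Rightarrow> nat \<Rightarrow> ('a \<times> 'a) list" where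
  "arrows T n m \<equiv> map (\<lambda>k. rauzy_arrow (orb T k)) [n..<m]"

text \<open>The Rauzy cocycle between the times \<open>n\<close> and \<open>m\<close>.\<close>

definition cmat :: "('a::finite) iet \<Rightarrow> nat \<Rightarrow> nat \<Rightarrow> real ^ 'a ^ 'a" where
  "cmat T n m = path_mat (arrows T n m)"

locale iet_orbit =
  fixes T :: "('a::finite) iet"
  assumes iet: "is_iet T" and adm: "admissible T" and card2: "CARD('a) \<ge> 2"
begin

text \<open>Only the steps before \<open>n\<close> are assumed to exist, so the result can be used
  to prove that step \<open>n\<close> exists as well.\<close>

lemma orbit_upto:
  assumes "\<And>k. k < n \<Longrightarrow> rauzy (orb T k) \<noteq> None"
  shows "is_iet (orb T n) \<and> admissible (orb T n) \<and> tower T (orb T n) (rtime T n) (htime T n)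
    \<and> heights_le (orb T n) (rtime T n) (htime T n)"
  using assms
proof (induction n)
  case 0 thus ?case using iet adm tower_refl by (auto simp: heights_le_def)
next
  case (Suc n)
  then interpret s: rauzy_step "orb T n" using card2 by unfold_locales auto
  have "tower T (orb T n) (rtime T n) (htime T n)" and J: "heights_le (orb T n) (rtime T n) (htime T n)"
    using Suc by auto
  from towerD(5)[OF this(1) s.a_gt1] have "heights_le (orb T (Suc n)) (rtime T (Suc n)) (htime T (Suc n))"
    using s.heights_step_bot[OF J] s.heights_step_top[OF J] strong_imp_heights_le by fastforce
  thus ?case using Suc s.iet_rz s.admissible_rz s.tower_step by auto
qed

lemma orbit_of_iterate:
  "iterate_partial rauzy n T = Some S \<Longrightarrow> S = orb T n \<and> (\<forall>k<n. rauzy (orb T k) \<noteq> None)"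
proof (induction n arbitrary: S)
  case (Suc n)
  then obtain S' where S': "iterate_partial rauzy n T = Some S'" "rauzy S' = Some S"
    by (auto simp: bind_eq_Some_conv)
  with Suc.IH[OF S'(1)] show ?case by (auto simp: less_Suc_eq)
qed simp

end

locale inf_orbit = iet_orbit +
  assumes inf: "\<And>k. rauzy (orb T k) \<noteq> None"
begin

lemma orb_iet: "is_iet (orb T n)" and orb_adm: "admissible (orb T n)"
  and orb_tower: "tower T (orb T n) (rtime T n) (htime T n)"
  and orb_heights: "heights_le (orb T n) (rtime T n) (htime T n)"
  using orbit_upto[of n] inf by auto

sublocale st: rauzy_step "orb T n" for n
  using orb_iet orb_adm card2 inf by unfold_locales auto

abbreviation "w n \<equiv> winner (orb T n)"
abbreviation "l n \<equiv> loser (orb T n)"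
abbreviation "lam n \<equiv> len (orb T n)"
abbreviation "tot n \<equiv> total_len (orb T n)"

lemma lam_pos: "lam n \<alpha> > 0" using st.t.pos .

lemma lam_Suc: "lam n \<alpha> = lam (Suc n) \<alpha> + (if \<alpha> = w n then lam (Suc n) (l n) else 0)"
  using st.winner_neq_loser[of n] by (simp add: st.len_rz)

lemma lam_antimono: "n \<le> m \<Longrightarrow> lam m \<alpha> \<le> lam n \<alpha>"
  by (rule lift_Suc_antimono_le[of "\<lambda>n. lam n \<alpha>"]) (auto simp: st.len_rz_le)

lemma lam_le_tot: "lam n \<alpha> \<le> tot n"
  unfolding total_len_def by (rule member_le_sum) (auto simp: less_imp_le[OF lam_pos])

lemma tot_pos: "tot n > 0" using lam_pos[of n undefined] lam_le_tot[of n undefined] by linarith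

lemma tot_antimono: "n \<le> m \<Longrightarrow> tot m \<le> tot n"
  unfolding total_len_def by (intro sum_mono lam_antimono)

lemma rtime_mono: "n \<le> m \<Longrightarrow> rtime T n \<alpha> \<le> rtime T m \<alpha>"
  by (rule lift_Suc_mono_le[of "\<lambda>n. rtime T n \<alpha>"]) (auto simp: rt_step_def)

lemma htime_mono: "n \<le> m \<Longrightarrow> htime T n \<alpha> \<le> htime T m \<alpha>"
  by (rule lift_Suc_mono_le[of "\<lambda>n. htime T n \<alpha>"]) (auto simp: ht_step_def)

lemma rauzy_path_orb: "rauzy_path m (orb T n) = Some (arrows T n (n + m))"
proof (induction m arbitrary: n)
  case (Suc m)
  obtain S where S: "rauzy (orb T n) = Some S" using inf by blast
  hence "S = orb T (Suc n)" by simp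
  hence "rauzy_path m S = Some (arrows T (Suc n) (Suc n + m))" using Suc.IH[of "Suc n"] by (simp only:)
  thus ?case by (simp add: S upt_conv_Cons del: upt_Suc)
qed simp

lemma iterate_orb: "iterate_partial rauzy m (orb T n) = Some (orb T (n + m))"
  using inf by (induction m) auto

section \<open>The cocycle and its action on lengths and return times\<close>

lemma path_mat_append: "path_mat (xs @ ys) = path_mat ys ** path_mat xs"
  by (induction xs) (auto simp: matrix_mul_assoc)

lemma cmat_refl: "cmat T n n $ i $ j = (if i = j then 1 else 0)"
  by (simp add: cmat_def mat_def)

lemma arrow_mat_mult: "(arrow_mat (u, v) ** M) $ i $ j = M $ i $ j + (if i = v then M $ u $ j else 0)"
proof -
  have "(arrow_mat (u, v) ** M) $ i $ j = (\<Sum>k\<in>UNIV. (if k = i then M $ k $ j else 0) + (if k = u then (if i = v then M $ k $ j else 0) else 0))"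
    unfolding matrix_matrix_mult_def arrow_mat_def
    by (auto intro!: sum.cong simp: axis_def algebra_simps)
  thus ?thesis by (simp add: sum.distrib)
qed

text \<open>Later matrices multiply on the left, so a step is a row operation; entries therefore
  stay natural and never decrease.\<close>

lemma cmat_Suc:
  assumes "n \<le> m"
  shows "cmat T n (Suc m) $ i $ j = cmat T n m $ i $ j + (if i = l m then cmat T n m $ w m $ j else 0)"
proof -
  have "cmat T n (Suc m) = arrow_mat (w m, l m) ** cmat T n m"
    using assms by (simp add: cmat_def path_mat_append matrix_mul_lid)
  thus ?thesis by (simp only: arrow_mat_mult)
qed

lemma cmat_Nats: "n \<le> m \<Longrightarrow> cmat T n m $ i $ j \<in> \<nat>"
  by (induction m arbitrary: i rule: dec_induct) (auto simp: cmat_refl cmat_Suc)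

lemma cmat_nonneg: "n \<le> m \<Longrightarrow> cmat T n m $ i $ j \<ge> 0"
  using cmat_Nats[of n m i j] by (auto elim: Nats_cases)

lemma cmat_mono: "n \<le> m \<Longrightarrow> m \<le> k \<Longrightarrow> cmat T n m $ i $ j \<le> cmat T n k $ i $ j"
  for i j
proof (rotate_tac, induction k rule: dec_induct)
  case (step k)
  have "cmat T n k $ i $ j \<le> cmat T n (Suc k) $ i $ j"
    using step cmat_nonneg[of n k "w k" j] by (simp add: cmat_Suc)
  with step show ?case by simp
qed simp

text \<open>Entry \<open>(i, \<alpha>)\<close> counts the visits of the points of cell
  \<open>i\<close> of time \<open>m\<close> to cell \<alpha> of time \<open>n\<close> before they
  return. Hence lengths are summed along columns, and return times along rows in
  \<open>rtime_cmat\<close>.\<close>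

lemma lam_cmat: "n \<le> m \<Longrightarrow> lam n \<alpha> = (\<Sum>i\<in>UNIV. cmat T n m $ i $ \<alpha> * lam m i)"
proof (induction m rule: dec_induct)
  case base
  have "(\<Sum>i\<in>UNIV. cmat T n n $ i $ \<alpha> * lam n i) = (\<Sum>i\<in>UNIV. if i = \<alpha> then lam n i else 0)"
    by (rule sum.cong) (auto simp: cmat_refl)
  thus ?case by simp
next
  case (step m)
  let ?c = "\<lambda>i. cmat T n m $ i $ \<alpha>"
  have "lam n \<alpha> = (\<Sum>i\<in>UNIV. ?c i * lam (Suc m) i + (if i = w m then ?c i * lam (Suc m) (l m) else 0))"
    unfolding step.IH by (rule sum.cong) (auto simp: lam_Suc[of m] distrib_left simp del: orb.simps)
  also have "\<dots> = (\<Sum>i\<in>UNIV. ?c i * lam (Suc m) i) + ?c (w m) * lam (Suc m) (l m)"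
    by (simp add: sum.distrib del: orb.simps)
  also have "\<dots> = (\<Sum>i\<in>UNIV. ?c i * lam (Suc m) i + (if i = l m then ?c (w m) * lam (Suc m) i else 0))"
    by (simp add: sum.distrib del: orb.simps)
  also have "\<dots> = (\<Sum>i\<in>UNIV. cmat T n (Suc m) $ i $ \<alpha> * lam (Suc m) i)"
    by (rule sum.cong) (auto simp: cmat_Suc step.hyps distrib_right simp del: orb.simps)
  finally show ?case .
qed

lemma rtime_cmat: "n \<le> m \<Longrightarrow> real (rtime T m i) = (\<Sum>\<alpha>\<in>UNIV. cmat T n m $ i $ \<alpha> * real (rtime T n \<alpha>))"
proof (induction m arbitrary: i rule: dec_induct)
  case base
  have "(\<Sum>\<alpha>\<in>UNIV. cmat T n n $ i $ \<alpha> * real (rtime T n \<alpha>)) = (\<Sum>\<alpha>\<in>UNIV. if \<alpha> = i then real (rtime T n \<alpha>) else 0)"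
    by (rule sum.cong) (auto simp: cmat_refl)
  thus ?case by simp
next
  case (step m)
  have "(\<Sum>\<alpha>\<in>UNIV. cmat T n (Suc m) $ i $ \<alpha> * real (rtime T n \<alpha>)) =
     real (rtime T m i) + (if i = l m then real (rtime T m (w m)) else 0)"
    by (auto simp: cmat_Suc step distrib_right sum.distrib)
  thus ?case by (simp add: rt_step_def)
qed

text \<open>A single term of the sum in \<open>lam_cmat\<close>; it turns bounds on lengths into
  bounds on matrix entries.\<close>

lemma cmat_le: "n \<le> m \<Longrightarrow> cmat T n m $ i $ \<alpha> * lam m i \<le> lam n \<alpha>"
  by (subst (2) lam_cmat, assumption, rule member_le_sum)
    (auto intro!: mult_nonneg_nonneg cmat_nonneg less_imp_le[OF lam_pos])

lemma positive_time_orb: "positive_time (orb T n) r \<longleftrightarrow> 1 \<le> r \<and> (\<forall>i j. cmat T n (n + r) $ i $ j > 0)"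
  by (auto simp: positive_time_def rauzy_path_orb positive_path_def cmat_def)

lemma pos_accel_orb:
  assumes "\<exists>r. positive_time (orb T n) r"
  shows "pos_accel (orb T n) = Some (orb T (n + first_positive_time (orb T n)))"
  using assms by (simp add: pos_accel_def iterate_orb)

lemma accel_mat_orb: "accel_mat (orb T n) = cmat T n (n + first_positive_time (orb T n))"
  by (simp add: accel_mat_def rauzy_path_orb cmat_def)

lemma first_positive: "\<exists>r. positive_time (orb T n) r \<Longrightarrow> positive_time (orb T n) (first_positive_time (orb T n))"
  unfolding first_positive_time_def by (rule LeastI_ex)

end

lemma max_norm_le_iff: "max_norm (M :: real ^ 'a::finite ^ 'a) \<le> C \<longleftrightarrow> (\<forall>i j. \<bar>M $ i $ j\<bar> \<le> C)"
proof -
  have "{\<bar>M $ i $ j\<bar> | i j. True} = (\<lambda>(i, j). \<bar>M $ i $ j\<bar>) ` UNIV" by auto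
  hence "finite {\<bar>M $ i $ j\<bar> | i j. True}" "{\<bar>M $ i $ j\<bar> | i j. True} \<noteq> {}" by auto
  thus ?thesis unfolding max_norm_def by (subst Max_le_iff) auto
qed

subsection \<open>Separation of the singularities\<close>

lemma sing_eq:
  assumes "is_iet T" "x \<in> iet_dom T" "(iet_map T ^^ i) x = utop T \<alpha>"
  shows "sing T (i, \<alpha>) = x"
  using inv_pow_eq[OF assms] by (simp add: sing_def)

lemma finite_sing_idx: "finite (sing_idx T n)"
  by (rule finite_subset[of _ "{..<n} \<times> UNIV"]) (auto simp: sing_idx_def)

lemma finite_sep_set: "finite {dist (sing T p) (sing T q) | p q. p \<in> sing_idx T n \<and> q \<in> sing_idx T n \<and> p \<noteq> q}"
  by (rule finite_subset[of _ "(\<lambda>(p, q). dist (sing T p) (sing T q)) ` (sing_idx T n \<times> sing_idx T n)"])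
    (auto simp: finite_sing_idx)

lemma sep_le:
  assumes "p \<in> sing_idx T n" "q \<in> sing_idx T n" "p \<noteq> q"
  shows "sep T n \<le> dist (sing T p) (sing T q)"
  unfolding sep_def using assms by (intro Min_le finite_sep_set CollectI exI conjI) (rule refl)

text \<open>As long as no backward orbit descends below the base, every singularity is the left end
  of its own floor, and the floors are disjoint intervals of length at least \<delta>.\<close>

lemma sep_ge_tower:
  assumes T: "is_iet T" and S: "is_iet S" and tw: "tower T S r h" and c2: "CARD('a) \<ge> 2" and n: "n \<ge> 2"
    and h: "\<And>\<beta>. ptop S \<beta> > 1 \<Longrightarrow> n \<le> Suc (h \<beta>)" and \<delta>: "\<And>\<alpha>. \<delta> \<le> len S \<alpha>"
  shows "\<delta> \<le> sep (T :: 'a::finite iet) n"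
proof -
  note D = towerD[OF tw]
  interpret t: row "ptop T" "len T" using rows T by auto
  let ?f = "iet_map T"
  have uT: "utop S \<alpha> \<in> iet_dom T" for \<alpha> using D(7) cell_dom[OF S utop_cell[OF S]] by auto
  \<comment> \<open>Going back \<open>i\<close> steps from height \<open>h \<alpha>\<close> descends
    to height \<open>h \<alpha> - i\<close> over the same point.\<close>
  have sg: "sing T (i, \<alpha>) = (?f ^^ (h \<alpha> - i)) (utop S \<alpha>)" if "(i, \<alpha>) \<in> sing_idx T n" for i \<alpha>
  proof (rule sing_eq[OF T])
    have p: "ptop S \<alpha> > 1" "i \<le> h \<alpha>" using that D(8)[of \<alpha>] h[of \<alpha>] by (auto simp: sing_idx_def)
    have "(?f ^^ i) ((?f ^^ (h \<alpha> - i)) (utop S \<alpha>)) = (?f ^^ (i + (h \<alpha> - i))) (utop S \<alpha>)"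
      by (simp only: funpow_add o_apply)
    thus "(?f ^^ i) ((?f ^^ (h \<alpha> - i)) (utop S \<alpha>)) = utop T \<alpha>" using D(6)[OF p(1)] p(2) by simp
    show "(?f ^^ (h \<alpha> - i)) (utop S \<alpha>) \<in> iet_dom T" by (rule iet_map_pow_dom[OF T uT])
  qed
  have *: "\<delta> \<le> y - x" if p: "p \<in> sing_idx T n" "q \<in> sing_idx T n" "p \<noteq> q" and xy: "x = sing T p" "y = sing T q" "x \<le> y" for p q x y
  proof (rule ccontr)
    assume lt: "\<not> \<delta> \<le> y - x"
    obtain i \<alpha> j \<beta> where pq: "p = (i, \<alpha>)" "q = (j, \<beta>)" by (metis surj_pair)
    have gt: "ptop S \<alpha> > 1" "ptop S \<beta> > 1" using p D(8) by (auto simp: pq sing_idx_def)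
    have ih: "i \<le> h \<alpha>" "j \<le> h \<beta>" using p h[OF gt(1)] h[OF gt(2)] by (auto simp: pq sing_idx_def)
    define a' where "a' = h \<alpha> - i" define b' where "b' = h \<beta> - j"
    have ab: "a' < r \<alpha>" "b' < r \<beta>" using D(5)[OF gt(1)] D(5)[OF gt(2)] by (auto simp: a'_def b'_def)
    have x: "x = (?f ^^ a') (utop S \<alpha>)" and y: "y = (?f ^^ b') (utop S \<beta>)"
      using sg p xy by (auto simp: pq a'_def b'_def)
    \<comment> \<open>If \<open>y\<close> were within \<delta> to the right of \<open>x\<close>, it
      would lie on the same floor, above the point \<open>z\<close> of the base cell.\<close>
    define z where "z = utop S \<alpha> + (y - x)"
    have z: "z \<in> cell S \<alpha>" using lt xy(3) \<delta>[of \<alpha>] by (auto simp: cell_def z_def)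
    have zd: "z \<in> iet_dom S" by (rule cell_dom[OF S z])
    have ud: "utop S \<beta> \<in> iet_dom S" by (rule cell_dom[OF S utop_cell[OF S]])
    have e: "(?f ^^ a') z = (?f ^^ b') (utop S \<beta>)"
      using D(3)[OF z utop_cell[OF S] ab(1)] x y by (simp add: z_def)
    \<comment> \<open>Cancelling common iterates, a difference in height would make one base point
      return too early.\<close>
    have "a' = b' \<and> z = utop S \<beta>"
    proof (cases "a' \<le> b'")
      case True
      have "(?f ^^ a') z = (?f ^^ a') ((?f ^^ (b' - a')) (utop S \<beta>))"
        unfolding e using True by (metis funpow_add le_add_diff_inverse o_apply)
      hence ze: "z = (?f ^^ (b' - a')) (utop S \<beta>)"
        using iet_map_pow_inj[OF T] zd D(7) iet_map_pow_dom[OF T uT] by blast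
      have "b' - a' < r \<beta>" using ab by simp
      hence "\<not> 0 < b' - a'" using D(2)[OF utop_cell[OF S], of "b' - a'" \<beta>] zd ze by auto
      thus ?thesis using True ze by simp
    next
      case False
      have "(?f ^^ b') (utop S \<beta>) = (?f ^^ b') ((?f ^^ (a' - b')) z)"
        unfolding e[symmetric] using False by (metis funpow_add le_add_diff_inverse nat_le_linear o_apply)
      hence ze: "utop S \<beta> = (?f ^^ (a' - b')) z"
        using iet_map_pow_inj[OF T uT] zd D(7) iet_map_pow_dom[OF T] by blast
      thus ?thesis using D(2)[OF z, of "a' - b'"] ud ab False by auto
    qed
    hence "a' = b'" "\<alpha> = \<beta>" using cell_uniq[OF S z] utop_cell[OF S, of \<beta>] by auto
    thus False using p(3) ih by (auto simp: pq a'_def b'_def)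
  qed
  have le: "\<delta> \<le> dist (sing T p) (sing T q)" if p: "p \<in> sing_idx T n" "q \<in> sing_idx T n" "p \<noteq> q" for p q
    using *[OF p refl refl] *[OF p(2,1) p(3)[symmetric] refl refl]
    by (cases "sing T p \<le> sing T q") (auto simp: dist_real_def)
  \<comment> \<open>\<open>Min\<close> is informative only for a nonempty set;
    \<open>n \<ge> 2\<close> supplies two indices with the same letter.\<close>
  obtain \<beta> where "ptop T \<beta> > 1" using t.p_last c2 by (metis less_le_trans one_less_numeral_iff semiring_norm(76))
  hence "(0, \<beta>) \<in> sing_idx T n" "(1, \<beta>) \<in> sing_idx T n" using n by (auto simp: sing_idx_def)
  hence "{dist (sing T p) (sing T q) | p q. p \<in> sing_idx T n \<and> q \<in> sing_idx T n \<and> p \<noteq> q} \<noteq> {}" by fastforce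
  thus ?thesis unfolding sep_def using le finite_sep_set[of T n] by (subst Min_ge_iff) auto
qed

subsection \<open>Bounded positive acceleration implies bounded type\<close>

context inf_orbit
begin

text \<open>If the left end differs at the two times, it moved at some step in between, and every
  move adds a full return time.\<close>

lemma htime_grows:
  assumes nm: "n \<le> m" and p: "ptop T \<beta> > 1" and u: "utop (orb T m) \<beta> \<noteq> utop (orb T n) \<beta>"
    and k: "\<And>i. k \<le> rtime T n i"
  shows "htime T n \<beta> + k \<le> htime T m \<beta>"
proof -
  have "\<exists>j. n \<le> j \<and> j < m \<and> utop (orb T (Suc j)) \<beta> \<noteq> utop (orb T j) \<beta>"
  proof (rule ccontr)
    assume c: "\<not> ?thesis"
    from nm have "utop (orb T m) \<beta> = utop (orb T n) \<beta>"
      by (induction m rule: dec_induct) (use c nm in \<open>auto simp del: orb.simps\<close>)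
    with u show False by simp
  qed
  then obtain j where j: "n \<le> j" "j < m" "utop (orb T (Suc j)) \<beta> \<noteq> utop (orb T j) \<beta>" by blast
  hence "htime T (Suc j) \<beta> = htime T j \<beta> + rtime T j (w j)" using st.utop_rz_changed by simp
  moreover have "htime T (Suc j) \<beta> \<le> htime T m \<beta>" "htime T n \<beta> \<le> htime T j \<beta>" "k \<le> rtime T j (w j)"
    using htime_mono[of "Suc j" m] htime_mono[of n j] j rtime_mono[of n j "w j"] k[of "w j"] by auto
  ultimately show ?thesis by linarith
qed

lemma bounded_typeI:
  assumes nk: "\<And>k. nk k \<le> nk (Suc k)" "nk 0 = 0"
    and c: "\<And>k i j. 1 \<le> cmat T (nk k) (nk (Suc k)) $ i $ j" "\<And>k i j. cmat T (nk k) (nk (Suc k)) $ i $ j \<le> C"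
  shows "bounded_type T"
proof -
  \<comment> \<open>\<open>D\<close> bounds the contraction of the domain over one block;
    \<open>rho\<close> is the sum of the return times at a block end.\<close>
  define D where "D = real CARD('a) * C"
  define rho where "rho k = (\<Sum>\<alpha>\<in>UNIV. rtime T (nk k) \<alpha>)" for k
  have "1 \<le> C" using c[of 0 undefined undefined] by linarith
  hence D: "D > 0" using card2 by (auto simp: D_def)
  have lam_ge: "tot (nk (Suc k)) \<le> lam (nk k) \<alpha>" for k \<alpha>
    unfolding lam_cmat[OF nk(1)[of k]] total_len_def
    by (rule sum_mono) (metis c(1) lam_pos less_imp_le mult_1 mult_right_mono)
  have "lam (nk k) \<alpha> \<le> C * tot (nk (Suc k))" for k \<alpha>
    unfolding lam_cmat[OF nk(1)[of k]] total_len_def sum_distrib_left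
    by (rule sum_mono, rule mult_right_mono) (use c(2) lam_pos in \<open>auto simp: less_imp_le\<close>)
  hence tot_le: "tot (nk k) \<le> D * tot (nk (Suc k))" for k
    using sum_bounded_above[of UNIV "lam (nk k)" "C * tot (nk (Suc k))"]
    by (simp add: total_len_def[of "orb T (nk k)"] D_def mult.assoc)
  have tot4: "tot (nk k) \<le> D ^ 4 * tot (nk (k + 4))" for k
  proof -
    have "D ^ j * tot (nk (k + j)) \<le> D ^ Suc j * tot (nk (k + Suc j))" for j
      using mult_left_mono[OF tot_le[of "k + j"], of "D ^ j"] D by (simp add: mult_ac)
    from lift_Suc_mono_le[of "\<lambda>j. D ^ j * tot (nk (k + j))" 0 4, OF this] show ?thesis by simp
  qed
  have rge: "rho k \<le> rtime T (nk (Suc k)) i" for k i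
  proof -
    have "real (rho k) \<le> real (rtime T (nk (Suc k)) i)"
      unfolding rtime_cmat[OF nk(1)[of k]] rho_def of_nat_sum
      by (rule sum_mono) (use c(1) in \<open>simp add: mult_le_cancel_right1\<close>)
    thus ?thesis by simp
  qed
  have hge: "rho k \<le> htime T (nk (Suc (Suc k))) \<beta>" if p: "ptop T \<beta> > 1" for k \<beta>
  proof -
    let ?n = "nk (Suc k)" and ?m = "nk (Suc (Suc k))"
    have gt: "ptop (orb T i) \<beta> > 1" for i using towerD(8)[OF orb_tower] p by blast
    \<comment> \<open>The old left end is at least one old cell away from 0, hence beyond the whole
      domain one block later, so it must have moved.\<close>
    obtain \<alpha> where "lam ?n \<alpha> \<le> utop (orb T ?n) \<beta>" using st.t.off_pos[OF gt] by (auto simp: utop_offset)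
    moreover have "utop (orb T ?m) \<beta> < tot ?m"
      using cell_dom[OF orb_iet utop_cell[OF orb_iet]] by (auto simp: iet_dom_def)
    ultimately have "utop (orb T ?m) \<beta> \<noteq> utop (orb T ?n) \<beta>" using lam_ge[of "Suc k" \<alpha>] by auto
    from htime_grows[OF nk(1) p this, of "rho k"] rge show ?thesis by fastforce
  qed
  have rho0: "rho 0 = CARD('a)" by (simp add: rho_def nk)
  have rho_Suc: "2 * rho k \<le> rho (Suc k)" for k
  proof -
    have "CARD('a) * rho k \<le> rho (Suc k)" unfolding rho_def[of "Suc k"]
      using sum_bounded_below[of UNIV "rho k" "rtime T (nk (Suc k))"] rge by simp
    thus ?thesis using card2 by (meson le_trans mult_le_mono1)
  qed
  have rho_pos: "rho k > 0" for k
    using rho0 card2 by (induction k) (auto intro: less_le_trans[OF _ rho_Suc])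
  have rho_unb: "k \<le> rho k" for k
  proof (induction k)
    case (Suc k) thus ?case using rho_Suc[of k] rho_pos[of k] by linarith
  qed simp
  have area: "tot 0 \<le> real (rho k) * tot (nk k)" for k
  proof -
    have "tot 0 = (\<Sum>\<alpha>\<in>UNIV. real (rtime T (nk k) \<alpha>) * lam (nk k) \<alpha>)" using towerD(9)[OF orb_tower] by simp
    also have "\<dots> \<le> (\<Sum>\<alpha>\<in>UNIV. real (rtime T (nk k) \<alpha>) * tot (nk k))"
      by (intro sum_mono mult_left_mono lam_le_tot) auto
    finally show ?thesis by (simp add: rho_def sum_distrib_right)
  qed
  have key: "1 / D ^ 4 \<le> real n * sep T n / total_len T" if n: "n > CARD('a)" for n
  proof -
    have ex: "\<exists>k. n \<le> rho k" using rho_unb by blast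
    \<comment> \<open>Since \<open>n\<close> exceeds \<open>rho 0\<close>, the number of letters,
      \<open>K\<close> is some \<open>Suc k\<close>. At block \<open>K + 2 = k + 3\<close> all
      heights reach \<open>n\<close>, and the cells there are at least as long as the domain of
      block \<open>k + 4\<close>; this is why \<open>tot4\<close> spans four blocks. Finally
      \<open>rho k < n\<close> bounds the domain of block \<open>k\<close> from below by
      \<open>tot 0 / n\<close>.\<close>
    define K where "K = (LEAST k. n \<le> rho k)"
    have K: "n \<le> rho K" unfolding K_def by (rule LeastI_ex[OF ex])
    have "K \<noteq> 0" using K n rho0 by (intro notI) simp
    then obtain k where k: "K = Suc k" using not0_implies_Suc by blast
    have less: "rho k < n" using not_less_Least[of k "\<lambda>k. n \<le> rho k"] k by (simp add: K_def)
    have "tot (nk (k + 4)) \<le> sep T n"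
    proof (rule sep_ge_tower[OF iet orb_iet orb_tower card2])
      show "n \<ge> 2" using n card2 by simp
      show "tot (nk (k + 4)) \<le> lam (nk (k + 3)) \<alpha>" for \<alpha> using lam_ge[of "k + 3"] by (simp add: numeral_eq_Suc)
      show "n \<le> Suc (htime T (nk (k + 3)) \<beta>)" if "ptop (orb T (nk (k + 3))) \<beta> > 1" for \<beta>
      proof -
        have "ptop T \<beta> > 1" using that towerD(8)[OF orb_tower] by blast
        from hge[OF this, of K] K show ?thesis by (simp add: k numeral_eq_Suc)
      qed
    qed
    hence 1: "tot (nk k) \<le> D ^ 4 * sep T n"
      using D by (intro order_trans[OF tot4[of k] mult_left_mono]) simp_all
    have "tot 0 \<le> real (rho k) * tot (nk k)" by (rule area)
    also have "\<dots> \<le> real n * (D ^ 4 * sep T n)"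
      using less 1 by (intro mult_mono) (auto simp: less_imp_le[OF tot_pos])
    finally have "total_len T \<le> D ^ 4 * (real n * sep T n)" by (simp add: mult_ac)
    moreover have "total_len T > 0" using tot_pos[of 0] by simp
    ultimately show ?thesis using D by (simp add: field_simps)
  qed
  have "ereal (1 / D ^ 4) \<le> sep_const T"
    unfolding sep_const_def by (rule Liminf_bounded) (use key in \<open>auto simp: eventually_sequentially intro!: exI[of _ "Suc CARD('a)"]\<close>)
  moreover have "0 < ereal (1 / D ^ 4)" using D by simp
  ultimately show ?thesis unfolding bounded_type_def by (rule less_le_trans[rotated])
qed

end

section \<open>The positive acceleration along the Rauzy orbit\<close>

lemma iterate_partial_add:
  "iterate_partial f (m + n) x = Option.bind (iterate_partial f m x) (iterate_partial f n)"
proof (induction n)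
  case (Suc n) thus ?case by (cases "iterate_partial f m x") auto
next
  case 0 thus ?case by (cases "iterate_partial f m x") auto
qed

text \<open>Every acceleration consumes at least one Rauzy step, so infinitely many accelerations
  force an infinite Rauzy orbit.\<close>

lemma iterate_pos_accel:
  "iterate_partial pos_accel k T = Some S \<Longrightarrow> \<exists>n\<ge>k. iterate_partial rauzy n T = Some S"
proof (induction k arbitrary: S)
  case (Suc k)
  then obtain S' where S': "iterate_partial pos_accel k T = Some S'" "pos_accel S' = Some S"
    by (auto simp: bind_eq_Some_conv)
  from Suc.IH[OF S'(1)] obtain n where n: "n \<ge> k" "iterate_partial rauzy n T = Some S'" by blast
  let ?r = "first_positive_time S'"
  have ex: "\<exists>r. positive_time S' r" and r: "iterate_partial rauzy ?r S' = Some S"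
    using S'(2) by (auto simp: pos_accel_def split: if_splits)
  have "?r \<ge> 1" using LeastI_ex[OF ex] by (simp add: first_positive_time_def positive_time_def)
  with n r show ?case by (intro exI[of _ "n + ?r"]) (simp add: iterate_partial_add)
qed (auto intro!: exI[of _ 0])

lemma (in iet_orbit) bounded_type_if_accel:
  assumes ex: "\<And>n. iterate_partial pos_accel n T \<noteq> None"
    and C: "\<And>n. max_norm (accel_mat (the (iterate_partial pos_accel n T))) \<le> C"
  shows "bounded_type T"
proof -
  have "rauzy (orb T k) \<noteq> None" for k
  proof -
    obtain S where "iterate_partial pos_accel (Suc k) T = Some S" using ex by blast
    from iterate_pos_accel[OF this] obtain n where "n \<ge> Suc k" "iterate_partial rauzy n T = Some S" by blast
    with orbit_of_iterate[of n S] show ?thesis by auto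
  qed
  then interpret inf_orbit T by unfold_locales
  \<comment> \<open>\<open>nk k\<close> is the number of Rauzy steps consumed by the first
    \<open>k\<close> accelerations.\<close>
  define nk where "nk = rec_nat 0 (\<lambda>_ n. n + first_positive_time (orb T n))"
  have nk: "nk 0 = 0" "nk (Suc k) = nk k + first_positive_time (orb T (nk k))" for k
    by (auto simp: nk_def)
  have pos: "\<exists>r. positive_time (orb T (nk k)) r" if "iterate_partial pos_accel k T = Some (orb T (nk k))" for k
    using ex[of "Suc k"] that by (auto simp: pos_accel_def split: if_splits)
  have it: "iterate_partial pos_accel k T = Some (orb T (nk k))" for k
  proof (induction k)
    case (Suc k) with pos_accel_orb[OF pos[OF Suc]] show ?case by (simp add: nk)
  qed (simp add: nk)
  show ?thesis
  proof (rule bounded_typeI[of nk C])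
    fix k i j
    show "nk k \<le> nk (Suc k)" "nk 0 = 0" by (simp_all add: nk)
    have "cmat T (nk k) (nk (Suc k)) $ i $ j > 0"
      using first_positive[OF pos[OF it[of k]]] by (simp add: positive_time_orb nk)
    \<comment> \<open>Entries are natural numbers, so positive ones are at least 1.\<close>
    with cmat_Nats[of "nk k" "nk (Suc k)" i j] show "1 \<le> cmat T (nk k) (nk (Suc k)) $ i $ j"
      by (auto simp: nk elim!: Nats_cases)
    have "max_norm (cmat T (nk k) (nk (Suc k))) \<le> C" using C[of k] by (simp add: it accel_mat_orb nk)
    thus "cmat T (nk k) (nk (Suc k)) $ i $ j \<le> C" by (auto simp: max_norm_le_iff intro: order_trans[OF abs_ge_self])
  qed
qed

subsection \<open>No gap in the lengths\<close>

context adm_iet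
begin

text \<open>Shrinking the letters outside \<open>A\<close> to length \<open>0\<close> changes positions by at most \<open>eta\<close>. If
  the relevant singularities and their preimages are more than \<open>eta\<close> apart, then the cells of \<open>A\<close> are
  contiguous in the domain, and comparing what is left over at both ends before and after the exchange
  shows that \<open>A\<close> is an initial segment of both rows.\<close>

lemma no_gap:
  fixes A :: "'a set"
  defines "eta \<equiv> sum (len S) (- A)"
  defines "good \<equiv> \<lambda>\<beta>. ptop S \<beta> > 1 \<and> (\<beta> \<in> A \<or> (\<exists>\<alpha>\<in>A. ptop S \<beta> = Suc (ptop S \<alpha>)))"
  assumes A: "A \<noteq> {}" "A \<noteq> UNIV"
    and big: "\<And>\<alpha>. \<alpha> \<in> A \<Longrightarrow> eta < len S \<alpha>"
    and G1: "\<And>\<beta> \<gamma>. good \<beta> \<Longrightarrow> good \<gamma> \<Longrightarrow> \<beta> \<noteq> \<gamma> \<Longrightarrow> eta < \<bar>utop S \<beta> - utop S \<gamma>\<bar>"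
    and G2: "\<And>\<beta> \<gamma> \<delta> x. good \<beta> \<Longrightarrow> good \<gamma> \<Longrightarrow> \<delta> \<in> A \<Longrightarrow> x \<in> cell S \<delta> \<Longrightarrow> iet_map S x = utop S \<beta>
       \<Longrightarrow> eta < \<bar>x - utop S \<gamma>\<bar>"
  shows False
proof -
  let ?p = "ptop S" and ?q = "pbot S" and ?U = "utop S" and ?V = "ubot S" and ?l = "len S"
  let ?L = "sum ?l A"
  have small: "sum ?l X \<le> eta" if "\<And>\<xi>. \<xi> \<in> X \<Longrightarrow> \<xi> \<notin> A" for X
    unfolding eta_def by (rule t.sum_pos_mono) (use that in auto)
  have eta0: "0 \<le> eta" using small[of "{}"] by simp
  \<comment> \<open>\<alpha> and \<omega> are the extreme letters of \<open>A\<close> on top,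
    \<open>e\<close> and \<open>f\<close> those on the bottom.\<close>
  obtain \<alpha> where al: "\<alpha> \<in> A" "\<And>\<gamma>. \<gamma> \<in> A \<Longrightarrow> ?p \<alpha> \<le> ?p \<gamma>" using t.ex_argmin[OF A(1)] by blast
  obtain \<omega> where om: "\<omega> \<in> A" "\<And>\<gamma>. \<gamma> \<in> A \<Longrightarrow> ?p \<gamma> \<le> ?p \<omega>" using t.ex_argmax[OF A(1)] by blast
  obtain e where e: "e \<in> A" "\<And>\<gamma>. \<gamma> \<in> A \<Longrightarrow> ?q e \<le> ?q \<gamma>" using b.ex_argmin[OF A(1)] by blast
  obtain f where f: "f \<in> A" "\<And>\<gamma>. \<gamma> \<in> A \<Longrightarrow> ?q \<gamma> \<le> ?q f" using b.ex_argmax[OF A(1)] by blast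
  have U: "?U \<xi> = (\<Sum>\<zeta> | ?p \<zeta> < ?p \<xi>. ?l \<zeta>)" and V: "?V \<xi> = (\<Sum>\<zeta> | ?q \<zeta> < ?q \<xi>. ?l \<zeta>)" for \<xi>
    by (simp_all add: utop_def ubot_def)
  have Uend: "?U \<xi> + ?l \<xi> = (\<Sum>\<zeta> | ?p \<zeta> \<le> ?p \<xi>. ?l \<zeta>)" and Vend: "?V \<xi> + ?l \<xi> = (\<Sum>\<zeta> | ?q \<zeta> \<le> ?q \<xi>. ?l \<zeta>)" for \<xi>
    using t.off_end b.off_end by (simp_all add: utop_offset ubot_offset)
  have contig: "\<xi> \<in> A" if between: "?p \<alpha> < ?p \<xi>" "?p \<xi> < ?p \<omega>" for \<xi>
  proof (rule ccontr)
    assume "\<xi> \<notin> A"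
    \<comment> \<open>\<beta> is the first letter missing from \<open>A\<close>, so its left
      neighbour is in \<open>A\<close>; \<gamma> is the next letter of \<open>A\<close>. Only
      letters outside \<open>A\<close> separate their left ends, which contradicts
      \<open>G1\<close>.\<close>
    let ?X = "{\<xi>. \<xi> \<notin> A \<and> ?p \<alpha> < ?p \<xi> \<and> ?p \<xi> < ?p \<omega>}"
    have "?X \<noteq> {}" using \<open>\<xi> \<notin> A\<close> between by blast
    from t.ex_argmin[OF this] obtain \<beta> where be: "\<beta> \<in> ?X" "\<And>\<gamma>. \<gamma> \<in> ?X \<Longrightarrow> ?p \<beta> \<le> ?p \<gamma>"
      by (elim bexE) (rule that, assumption, erule bspec)
    have b1: "?p \<beta> > 1" using be(1) t.p_ge1[of \<alpha>] by auto
    obtain \<beta>' where b': "?p \<beta> = Suc (?p \<beta>')" using t.p_pred[OF b1] by blast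
    have "\<beta>' \<in> A"
    proof (rule ccontr)
      assume n: "\<beta>' \<notin> A"
      hence ne: "?p \<beta>' \<noteq> ?p \<alpha>" using al(1) by auto
      have "?p \<alpha> < Suc (?p \<beta>')" "Suc (?p \<beta>') < ?p \<omega>" using be(1) b' by simp_all
      with ne have "?p \<alpha> < ?p \<beta>'" "?p \<beta>' < ?p \<omega>" by linarith+
      hence "\<beta>' \<in> ?X" using n by simp
      from be(2)[OF this] b' show False by simp
    qed
    hence gb: "good \<beta>" using b' b1 unfolding good_def by blast
    let ?Y = "{\<gamma>\<in>A. ?p \<beta> < ?p \<gamma>}"
    have "?Y \<noteq> {}" using om(1) be(1) by blast
    from t.ex_argmin[OF this] obtain \<gamma> where ga: "\<gamma> \<in> ?Y" "\<And>\<zeta>. \<zeta> \<in> ?Y \<Longrightarrow> ?p \<gamma> \<le> ?p \<zeta>"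
      by (elim bexE) (rule that, assumption, erule bspec)
    have gg: "good \<gamma>" using ga(1) b1 unfolding good_def by auto
    let ?Z = "{\<zeta>. ?p \<beta> \<le> ?p \<zeta> \<and> ?p \<zeta> < ?p \<gamma>}"
    have Z: "{\<zeta>. ?p \<zeta> < ?p \<gamma>} = {\<zeta>. ?p \<zeta> < ?p \<beta>} \<union> ?Z" using ga(1) by auto
    have "?U \<gamma> = ?U \<beta> + sum ?l ?Z" unfolding U Z by (rule sum.union_disjoint) auto
    moreover have "sum ?l ?Z \<le> eta"
    proof (rule small)
      fix \<zeta> assume z: "\<zeta> \<in> ?Z"
      show "\<zeta> \<notin> A"
      proof
        assume "\<zeta> \<in> A"
        have "?p \<beta> \<noteq> ?p \<zeta>" using \<open>\<zeta> \<in> A\<close> be(1) by auto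
        moreover have "?p \<beta> \<le> ?p \<zeta>" using z by simp
        ultimately have "?p \<beta> < ?p \<zeta>" by linarith
        thus False using ga(2)[of \<zeta>] z \<open>\<zeta> \<in> A\<close> by simp
      qed
    qed
    moreover have "sum ?l ?Z \<ge> 0" by (rule sum_nonneg) (simp add: less_imp_le[OF t.pos])
    moreover have "\<beta> \<noteq> \<gamma>" using ga(1) by auto
    ultimately show False using G1[OF gb gg] by linarith
  qed
  have Ual: "?U \<alpha> \<le> eta" unfolding U by (rule small) (metis al(2) mem_Collect_eq not_less)
  have Ve: "?V e \<le> eta" unfolding V by (rule small) (metis e(2) mem_Collect_eq not_less)
  have Ve0: "0 \<le> ?V e" using b.off_nonneg by (simp add: ubot_offset)
  have start: "?U \<alpha> < ?V e" if "?p \<alpha> > 1"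
  proof (rule ccontr)
    assume n: "\<not> ?thesis"
    \<comment> \<open>The preimage of \<open>?U \<alpha>\<close>. As
      \<open>?V e \<le> ?U \<alpha> \<le> eta\<close>, it lies in the cell of \<open>e\<close>
      within \<open>eta\<close> of the left end, against \<open>G2\<close>.\<close>
    let ?x = "?U e + (?U \<alpha> - ?V e)"
    have x: "?x \<in> cell S e" using n Ual Ve0 big[OF e(1)] by (auto simp: cell_def)
    have "?p e > 1" using that al(2)[OF e(1)] by linarith
    hence g: "good \<alpha>" "good e" using that al(1) e(1) unfolding good_def by blast+
    have "iet_map S ?x = ?U \<alpha>" using iet_map_cell[OF iet x] by simp
    from G2[OF g e(1) x this] show False using n Ual Ve0 by auto
  qed
  let ?zt = "?U \<omega> + ?l \<omega>" and ?zb = "?V f + ?l f"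
  have zb_le: "?zb \<le> ?zt"
  proof (rule ccontr)
    assume n: "\<not> ?thesis"
    have zbt: "?zb \<le> total_len S" using b.off_le_total by (simp add: ubot_offset total_len_def)
    have "\<omega> \<noteq> a" using n zbt utop_a by auto
    hence wl: "?p \<omega> < CARD('a)" using t.p_less_card by blast
    obtain \<omega>' where w': "?p \<omega>' = Suc (?p \<omega>)" using t.p_ex[of "Suc (?p \<omega>)"] wl by auto
    have Uw': "?U \<omega>' = ?zt" using t.off_Suc[OF w'] by (simp add: utop_offset)
    have gw: "good \<omega>'" using w' om(1) t.p_ge1[of \<omega>] unfolding good_def by auto
    have "UNIV = {\<zeta>. ?p \<zeta> \<le> ?p \<omega>} \<union> {\<zeta>. ?p \<zeta> > ?p \<omega>}" by auto
    hence "total_len S = sum ?l ({\<zeta>. ?p \<zeta> \<le> ?p \<omega>} \<union> {\<zeta>. ?p \<zeta> > ?p \<omega>})" by (simp add: total_len_def)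
    also have "\<dots> = ?zt + sum ?l {\<zeta>. ?p \<zeta> > ?p \<omega>}"
      unfolding Uend by (rule sum.union_disjoint) auto
    also have "sum ?l {\<zeta>. ?p \<zeta> > ?p \<omega>} \<le> eta" by (rule small) (metis om(2) mem_Collect_eq not_less)
    finally have d: "?zb - ?zt \<le> eta" using zbt by simp
    \<comment> \<open>Mirror image of \<open>start\<close>: the preimage of the left end of
      \<omega>' lies within \<open>eta\<close> of the right end of the cell of \<open>f\<close>,
      which is the left end of \<open>f'\<close>.\<close>
    let ?x = "?U f + (?zt - ?V f)"
    have x: "?x \<in> cell S f" using n d big[OF f(1)] by (auto simp: cell_def)
    have Tx: "iet_map S ?x = ?U \<omega>'" using iet_map_cell[OF iet x] Uw' by simp
    have "?p f < CARD('a)" using om(2)[OF f(1)] wl by simp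
    then obtain f' where f': "?p f' = Suc (?p f)" using t.p_ex[of "Suc (?p f)"] by auto
    have "good f'" using f' f(1) t.p_ge1[of f] unfolding good_def by auto
    moreover have "?U f' = ?U f + ?l f" using t.off_Suc[OF f'] by (simp add: utop_offset)
    ultimately show False using G2[OF gw _ f(1) x Tx] n d by fastforce
  qed
  have zt: "?zt = ?U \<alpha> + ?L"
  proof -
    have "{\<zeta>. ?p \<zeta> \<le> ?p \<omega>} = {\<zeta>. ?p \<zeta> < ?p \<alpha>} \<union> A" (is "?l = ?r")
    proof (intro equalityI subsetI)
      fix \<zeta> assume z: "\<zeta> \<in> ?l"
      consider "?p \<zeta> < ?p \<alpha>" | "?p \<zeta> = ?p \<alpha>" | "?p \<zeta> = ?p \<omega>" | "?p \<alpha> < ?p \<zeta>" "?p \<zeta> < ?p \<omega>"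
        using z by fastforce
      thus "\<zeta> \<in> ?r" using contig[of \<zeta>] al(1) om(1) by cases simp_all
    next
      fix \<zeta> assume "\<zeta> \<in> ?r"
      thus "\<zeta> \<in> ?l" using om(2) om(2)[OF al(1)] by auto
    qed
    moreover have "{\<zeta>. ?p \<zeta> < ?p \<alpha>} \<inter> A = {}" using al(2) by fastforce
    ultimately show ?thesis unfolding Uend unfolding U by (simp add: sum.union_disjoint)
  qed
  have zb: "?V e + ?L \<le> ?zb"
  proof -
    have "{\<zeta>. ?q \<zeta> < ?q e} \<inter> A = {}" using e(2) by fastforce
    hence "?V e + ?L = sum ?l ({\<zeta>. ?q \<zeta> < ?q e} \<union> A)" unfolding V by (simp add: sum.union_disjoint)
    also have "\<dots> \<le> ?zb" unfolding Vend
      by (rule t.sum_pos_mono) (use f(2) f(2)[OF e(1)] in auto)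
    finally show ?thesis .
  qed
  \<comment> \<open>\<open>?V e + ?L \<le> ?zb \<le> ?zt = ?U \<alpha> + ?L\<close> gives
    \<open>?V e \<le> ?U \<alpha>\<close>, which \<open>start\<close> excludes unless \<alpha> comes
    first.\<close>
  have "\<not> ?p \<alpha> > 1" using start zt zb zb_le by linarith
  hence "?p \<alpha> = 1" using t.p_ge1[of \<alpha>] by linarith
  hence U0: "?U \<alpha> = 0" using t.off_first by (simp add: utop_offset)
  \<comment> \<open>Now \<open>?zb \<le> ?L\<close>: the bottom letters up to \<open>f\<close>
    contain \<open>A\<close> and have no larger total length.\<close>
  have Aq: "A = {\<zeta>. ?q \<zeta> \<le> ?q f}"
    by (rule t.sum_pos_eq) (use f(2) Vend[of f] zb_le zt U0 in auto)
  have Ap: "A = {\<zeta>. ?p \<zeta> \<le> ?p \<omega>}"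
    by (rule t.sum_pos_eq) (use om(2) Uend[of \<omega>] zt U0 in auto)
  have "?p ` A = {1..card A}" using Ap t.image_initial[of "?p \<omega>"] t.p_le[of \<omega>] by simp
  moreover have "?q ` A = {1..card A}" using Aq b.image_initial[of "?q f"] b.p_le[of f] by simp
  ultimately show False using A adm unfolding admissible_def by (elim notE, intro exI[of _ A] conjI)
qed

end

text \<open>Starting from \<open>{x}\<close>, each application of \<open>ng\<close> adds one more
  letter at the cost of a factor \<open>K\<close>, until the alphabet is exhausted.\<close>

lemma no_gap_imp_bounded_ratio:
  fixes g :: "'a::finite \<Rightarrow> real"
  assumes K: "K \<ge> 1" and pos: "\<And>\<alpha>. g \<alpha> > 0"
    and ng: "\<And>A. A \<noteq> {} \<Longrightarrow> A \<noteq> UNIV \<Longrightarrow> \<exists>\<alpha>\<in>A. \<exists>\<beta>. \<beta> \<notin> A \<and> g \<alpha> < K * g \<beta>"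
  shows "g x \<le> K ^ CARD('a) * g y"
proof -
  have "\<exists>A. x \<in> A \<and> (A = UNIV \<or> card A \<ge> Suc k) \<and> (\<forall>\<alpha>\<in>A. g x \<le> K ^ k * g \<alpha>)" for k
  proof (induction k)
    case 0 thus ?case by (intro exI[of _ "{x}"]) auto
  next
    case (Suc k)
    then obtain A where A: "x \<in> A" "A = UNIV \<or> card A \<ge> Suc k" "\<And>\<alpha>. \<alpha> \<in> A \<Longrightarrow> g x \<le> K ^ k * g \<alpha>" by blast
    have up: "g x \<le> K ^ Suc k * g \<alpha>" if "\<alpha> \<in> A" for \<alpha>
    proof -
      have "1 * (K ^ k * g \<alpha>) \<le> K * (K ^ k * g \<alpha>)"
        using K pos[of \<alpha>] by (intro mult_right_mono) auto
      thus ?thesis using A(3)[OF that] by (simp add: mult_ac)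
    qed
    show ?case
    proof (cases "A = UNIV")
      case True thus ?thesis using up by (intro exI[of _ A]) auto
    next
      case False
      then obtain \<alpha> \<beta> where ab: "\<alpha> \<in> A" "\<beta> \<notin> A" "g \<alpha> < K * g \<beta>" using ng[of A] A(1) by blast
      have "g x \<le> K ^ k * (K * g \<beta>)"
        using A(3)[OF ab(1)] ab(3) K by (intro order_trans[OF A(3)[OF ab(1)] mult_left_mono]) auto
      thus ?thesis using up A(1,2) ab False by (intro exI[of _ "insert \<beta> A"]) (auto simp: mult_ac)
    qed
  qed
  from this[of "CARD('a)"] obtain A where A: "A = UNIV \<or> card A \<ge> Suc (CARD('a))" "\<And>\<alpha>. \<alpha> \<in> A \<Longrightarrow> g x \<le> K ^ CARD('a) * g \<alpha>" by blast
  have "card A \<le> CARD('a)" by (rule card_mono) auto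
  with A(1) have "A = UNIV" by auto
  with A(2) show ?thesis by auto
qed

subsection \<open>Bounded type implies balanced lengths\<close>

lemma bounded_typeD:
  assumes "bounded_type T" "total_len T > 0"
  obtains c where "c > 0"
    "\<And>n p q. n \<ge> 1 \<Longrightarrow> p \<in> sing_idx T n \<Longrightarrow> q \<in> sing_idx T n \<Longrightarrow> p \<noteq> q \<Longrightarrow> c / real n \<le> dist (sing T p) (sing T q)"
proof -
  obtain z where z: "0 < ereal z" "ereal z < sep_const T"
    using assms(1) ereal_dense2 unfolding bounded_type_def by blast
  from less_LiminfD[OF z(2)[unfolded sep_const_def]] obtain N where
    N: "\<And>n. n \<ge> N \<Longrightarrow> z < real n * sep T n / total_len T" by (auto simp: eventually_sequentially)
  define M where "M = max 1 N"
  \<comment> \<open>The lower limit controls only \<open>n \<ge> N\<close>. Other indices are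
    regarded as indices for \<open>m = max n M \<le> n * M\<close>, which costs the factor
    \<open>M\<close>.\<close>
  define c where "c = z * total_len T / real M"
  have "c > 0" using z(1) assms(2) by (auto simp: c_def M_def)
  moreover have "c / real n \<le> dist (sing T p) (sing T q)"
    if n: "n \<ge> 1" and p: "p \<in> sing_idx T n" "q \<in> sing_idx T n" "p \<noteq> q" for n p q
  proof -
    define m where "m = max n M"
    have m: "m \<ge> N" "m \<ge> 1" "n \<le> m" using n by (auto simp: m_def M_def)
    have "m \<le> n * M" using n by (auto simp: m_def M_def max_def)
    hence "real m \<le> real n * real M" by (metis of_nat_le_iff of_nat_mult)
    hence "z * total_len T / (real n * real M) \<le> z * total_len T / real m"
      using z(1) assms(2) m by (intro divide_left_mono) auto
    also have "\<dots> < sep T m" using N[OF m(1)] m(2) assms(2) by (simp add: field_simps)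
    also have "\<dots> \<le> dist (sing T p) (sing T q)" using p m(3) by (intro sep_le) (auto simp: sing_idx_def)
    finally show ?thesis by (simp add: c_def mult_ac)
  qed
  ultimately show ?thesis using that by blast
qed

text \<open>Preimages under \<open>S\<close> are preimages under \<open>T\<close>, with the return
  times added to the height.\<close>

lemma sing_tower:
  assumes T: "is_iet T" and S: "is_iet S" and tw: "tower T S r h" and p: "ptop S \<beta> > 1"
  shows "sing T (h \<beta>, \<beta>) = utop S \<beta>"
    "x \<in> cell S \<delta> \<Longrightarrow> iet_map S x = utop S \<beta> \<Longrightarrow> sing T (h \<beta> + r \<delta>, \<beta>) = x"
    "x \<in> cell S \<delta> \<Longrightarrow> iet_map S x \<in> cell S \<epsilon> \<Longrightarrow> iet_map S (iet_map S x) = utop S \<beta> \<Longrightarrow> sing T (h \<beta> + r \<epsilon> + r \<delta>, \<beta>) = x"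
proof -
  note D = towerD[OF tw]
  have dom: "x \<in> cell S \<delta> \<Longrightarrow> x \<in> iet_dom T" for x \<delta> using cell_dom[OF S] D(7) by blast
  show "sing T (h \<beta>, \<beta>) = utop S \<beta>"
    by (rule sing_eq[OF T dom[OF utop_cell[OF S]] D(6)[OF p]])
  show "x \<in> cell S \<delta> \<Longrightarrow> iet_map S x = utop S \<beta> \<Longrightarrow> sing T (h \<beta> + r \<delta>, \<beta>) = x"
    using D(6)[OF p] D(1)[of x \<delta>] by (intro sing_eq[OF T dom]) (simp_all add: funpow_add)
  show "x \<in> cell S \<delta> \<Longrightarrow> iet_map S x \<in> cell S \<epsilon> \<Longrightarrow> iet_map S (iet_map S x) = utop S \<beta> \<Longrightarrow> sing T (h \<beta> + r \<epsilon> + r \<delta>, \<beta>) = x"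
    using D(6)[OF p] D(1)[of x \<delta>] D(1)[of "iet_map S x" \<epsilon>] by (intro sing_eq[OF T dom]) (simp_all add: funpow_add)
qed

text \<open>At a tie \<open>S\<close> maps the left end of \<open>b\<close> to that of
  \<open>a\<close>, so one point would be a singularity with two different indices.\<close>

lemma (in adm_iet) rauzy_defined:
  assumes T: "is_iet T" and tw: "tower T S r h"
    and inj: "\<And>p q n. p \<in> sing_idx T n \<Longrightarrow> q \<in> sing_idx T n \<Longrightarrow> sing T p = sing T q \<Longrightarrow> p = q"
  shows "rauzy S \<noteq> None"
proof
  assume "rauzy S = None"
  hence tie: "len S a = len S b" by (auto simp: rauzy_def Let_def split: if_splits)
  note D = towerD[OF tw] and sg = sing_tower[OF T iet tw]
  have inj': "p = q" if "ptop S (snd p) > 1" "ptop S (snd q) > 1" "sing T p = sing T q" for p q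
    using inj[of p "Suc (max (fst p) (fst q))" q] that D(8) by (cases p; cases q) (auto simp: sing_idx_def)
  have Ta: "iet_map S (utop S b) = utop S a"
    using iet_map_cell[OF iet utop_cell[OF iet], of b] utop_a ubot_b tie by simp
  show False
  proof (cases "ptop S b > 1")
    case True
    have "sing T (h b, b) = sing T (h a + r b, a)"
      using sg(1)[OF True] sg(2)[OF a_gt1 utop_cell[OF iet] Ta] by simp
    from inj'[OF _ _ this] True a_gt1 a_neq_b show False by auto
  next
    case False
    hence b1: "ptop S b = 1" using t.p_ge1[of b] by simp
    hence Ub: "utop S b = 0" using t.off_first by (simp add: utop_offset)
    \<comment> \<open>Here the left end of \<open>b\<close> is 0, which is not a singularity; it is
      the image of the left end of the first bottom letter \<open>c\<close>, where the connection
      starts instead.\<close>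
    obtain c where c: "pbot S c = 1" using b.p_ex[of 1] card2 by auto
    hence Tc: "iet_map S (utop S c) = utop S b"
      using iet_map_cell[OF iet utop_cell[OF iet], of c] b.off_first Ub by (simp add: ubot_offset)
    have "c \<noteq> b" using c b.p_last card2 by auto
    hence c1: "ptop S c > 1" using b1 t.p_ge1[of c] t.p_eq_iff[of c b] by (metis le_neq_implies_less)
    have "sing T (h c, c) = sing T (h a + r b + r c, a)"
      using sg(1)[OF c1] sg(3)[OF a_gt1 utop_cell[OF iet, of c], of b] utop_cell[OF iet, of b] Tc Ta by simp
    from inj'[OF _ _ this] c1 a_gt1 have "h c = h a + r b + r c" "c = a" by auto
    with D(5)[OF c1] show False by simp
  qed
qed

section \<open>Separated singularities: infinite orbit and balanced lengths\<close>

locale sep_iet = iet_orbit +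
  fixes c :: real
  assumes c_pos: "c > 0"
    and c_sep: "\<And>n p q. n \<ge> 1 \<Longrightarrow> p \<in> sing_idx T n \<Longrightarrow> q \<in> sing_idx T n \<Longrightarrow> p \<noteq> q \<Longrightarrow> c / real n \<le> dist (sing T p) (sing T q)"

text \<open>Separation makes the family of singularities injective, which rules out ties by
  induction along the orbit.\<close>

sublocale sep_iet \<subseteq> inf_orbit
proof
  have inj: "p = q" if "p \<in> sing_idx T n" "q \<in> sing_idx T n" "sing T p = sing T q" for p q n
  proof (rule ccontr)
    assume "p \<noteq> q"
    moreover have n: "n \<ge> 1" using that(1) by (auto simp: sing_idx_def)
    ultimately have "c / real n \<le> 0" using c_sep[of n p q] that by simp
    moreover have "c / real n > 0" using c_pos n by simp
    ultimately show False by simp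
  qed
  fix k
  show "rauzy (orb T k) \<noteq> None"
  proof (induction k rule: less_induct)
    case (less k)
    from orbit_upto[of k, OF less] have o: "is_iet (orb T k)" "admissible (orb T k)" "tower T (orb T k) (rtime T k) (htime T k)" by auto
    interpret adm_iet "orb T k" using o card2 by unfold_locales
    show ?case by (rule rauzy_defined[OF iet_orbit.iet[OF iet_orbit_axioms] o(3)]) (rule inj)
  qed
qed

context sep_iet
begin

text \<open>If \<open>A\<close> were much longer than its complement, Kac's formula would bound the
  return times in \<open>A\<close>, so the singularities considered in \<open>no_gap\<close> would
  all occur before a time \<open>N\<close> with \<open>c / N\<close> above the total length outside
  \<open>A\<close>.\<close>

lemma strong_no_gap:
  assumes str: "strong_heights_le (orb T n) (rtime T n) (htime T n)" and A: "A \<noteq> {}" "A \<noteq> UNIV"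
  shows "\<exists>\<alpha>\<in>A. \<exists>\<beta>. \<beta> \<notin> A \<and> lam n \<alpha> < (4 * total_len T * CARD('a) / c + CARD('a) + 1) * lam n \<beta>"
proof (rule ccontr)
  define M where "M = total_len T"
  define d where "d = real CARD('a)"
  define K where "K = 4 * M * d / c + d + 1"
  let ?S = "orb T n" and ?r = "rtime T n" and ?h = "htime T n"
  assume "\<not> ?thesis"
  hence gap: "\<And>\<alpha> \<beta>. \<alpha> \<in> A \<Longrightarrow> \<beta> \<notin> A \<Longrightarrow> K * lam n \<beta> \<le> lam n \<alpha>"
    by (force simp: K_def M_def d_def not_less)
  have M: "M > 0" using tot_pos[of 0] by (simp add: M_def)
  have d: "d > 0" by (simp add: d_def)
  have K: "K > 0" "K > d" "K > 4 * M * d / c" using M d c_pos by (auto simp: K_def add_pos_pos)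
  define L where "L = Min (lam n ` A)"
  have L: "L \<in> lam n ` A" "\<And>\<alpha>. \<alpha> \<in> A \<Longrightarrow> L \<le> lam n \<alpha>" using A(1) by (auto simp: L_def)
  have Lpos: "L > 0" using L(1) lam_pos by auto
  define eta where "eta = sum (lam n) (- A)"
  have "K * eta \<le> d * L"
  proof -
    have "K * eta = (\<Sum>\<beta>\<in>-A. K * lam n \<beta>)" by (simp add: eta_def sum_distrib_left)
    also have "\<dots> \<le> real (card (- A)) * L"
      by (rule sum_bounded_above) (use gap L(1) in auto)
    also have "\<dots> \<le> d * L" using Lpos by (intro mult_right_mono) (auto simp: d_def card_mono)
    finally show ?thesis .
  qed
  hence etaK: "eta \<le> d * L / K" using K(1) by (simp add: field_simps)
  have "d * L / K < L" using K(1,2) Lpos by (simp add: field_simps)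
  hence eta_L: "eta < L" using etaK by simp
  \<comment> \<open>\<open>R\<close> bounds the return times in \<open>A\<close>. \<open>N\<close>
    exceeds \<open>2 * R\<close> to accommodate a height plus one return time, and
    \<open>N \<le> 4 * R\<close> because \<open>R \<ge> 1\<close>.\<close>
  define R where "R = M / L"
  define N where "N = Suc (nat \<lfloor>2 * R\<rfloor>)"
  have area: "(\<Sum>\<alpha>\<in>UNIV. real (?r \<alpha>) * lam n \<alpha>) = M" using towerD(9)[OF orb_tower] by (simp add: M_def)
  have rL: "real (?r \<alpha>) \<le> R" if "\<alpha> \<in> A" for \<alpha>
  proof -
    have "real (?r \<alpha>) * L \<le> real (?r \<alpha>) * lam n \<alpha>" using L(2)[OF that] by (intro mult_left_mono) auto
    also have "\<dots> \<le> M" unfolding area[symmetric]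
      by (rule member_le_sum) (auto intro!: mult_nonneg_nonneg less_imp_le[OF lam_pos])
    finally show ?thesis using Lpos by (simp add: R_def field_simps)
  qed
  obtain \<alpha>0 where "\<alpha>0 \<in> A" using A by blast
  hence R1: "R \<ge> 1" using rL[of \<alpha>0] towerD(4)[OF orb_tower, of n \<alpha>0] by linarith
  have N: "2 * R < real N" "real N \<le> 4 * R" using R1 by (auto simp: N_def) linarith+
  have etaN: "eta < c / real N"
  proof -
    have "4 * M * d < c * K" using K(3) c_pos by (simp add: field_simps)
    hence "d * L / K < c * L / (4 * M)" using K(1) M Lpos by (simp add: field_simps)
    also have "\<dots> = c / (4 * R)" using Lpos M by (simp add: R_def)
    also have "\<dots> \<le> c / real N" using N R1 c_pos by (intro divide_left_mono) auto
    finally show ?thesis using etaK by simp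
  qed
  have sepN: "eta < \<bar>sing T p - sing T q\<bar>"
    if "fst p < N" "fst q < N" "ptop ?S (snd p) > 1" "ptop ?S (snd q) > 1" "p \<noteq> q" for p q
  proof -
    have "p \<in> sing_idx T N" "q \<in> sing_idx T N" using that towerD(8)[OF orb_tower] by (cases p; cases q; auto simp: sing_idx_def)+
    from c_sep[OF _ this that(5)] etaN show ?thesis by (simp add: N_def dist_real_def)
  qed
  define good where "good \<beta> \<longleftrightarrow> ptop ?S \<beta> > 1 \<and> (\<beta> \<in> A \<or> (\<exists>\<alpha>\<in>A. ptop ?S \<beta> = Suc (ptop ?S \<alpha>)))" for \<beta>
  \<comment> \<open>The strong bound is essential here: a letter to the right of \<open>A\<close>
    has a height at most the return time of its neighbour in \<open>A\<close>.\<close>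
  have gh: "real (?h \<beta>) \<le> R" if g: "good \<beta>" for \<beta>
  proof (cases "\<beta> \<in> A")
    case True thus ?thesis using towerD(5)[OF orb_tower, of n \<beta>] g rL[OF True] by (auto simp: good_def)
  next
    case False
    then obtain \<alpha> where "\<alpha> \<in> A" "ptop ?S \<beta> = Suc (ptop ?S \<alpha>)" using g by (auto simp: good_def)
    with str rL[of \<alpha>] show ?thesis by (force simp: strong_heights_le_def)
  qed
  have g1: "good \<beta> \<Longrightarrow> ptop ?S \<beta> > 1" for \<beta> by (simp add: good_def)
  note sg = sing_tower[OF iet orb_iet orb_tower g1]
  show False
  proof (rule st.no_gap[of A n], fold eta_def good_def)
    show "A \<noteq> {}" "A \<noteq> UNIV" by fact+
    show "eta < lam n \<alpha>" if "\<alpha> \<in> A" for \<alpha> using eta_L L(2)[OF that] by simp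
    show "eta < \<bar>utop ?S \<beta> - utop ?S \<gamma>\<bar>" if g: "good \<beta>" "good \<gamma>" and ne: "\<beta> \<noteq> \<gamma>" for \<beta> \<gamma>
      using sepN[of "(?h \<beta>, \<beta>)" "(?h \<gamma>, \<gamma>)"] gh[OF g(1)] gh[OF g(2)] g1[OF g(1)] g1[OF g(2)] sg(1)[OF g(1)] sg(1)[OF g(2)] N R1 ne by auto
    show "eta < \<bar>x - utop ?S \<gamma>\<bar>"
      if g: "good \<beta>" "good \<gamma>" and de: "\<delta> \<in> A" and x: "x \<in> cell ?S \<delta>" "iet_map ?S x = utop ?S \<beta>" for \<beta> \<gamma> \<delta> x
    proof -
      have "(?h \<beta> + ?r \<delta>, \<beta>) \<noteq> (?h \<gamma>, \<gamma>)" using towerD(4)[OF orb_tower, of n \<delta>] by auto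
      moreover have "?h \<beta> + ?r \<delta> < N" "?h \<gamma> < N" using gh[OF g(1)] gh[OF g(2)] rL[OF de] N R1 by linarith+
      ultimately show ?thesis
        using sepN[of "(?h \<beta> + ?r \<delta>, \<beta>)" "(?h \<gamma>, \<gamma>)"] g1[OF g(1)] g1[OF g(2)] sg(2)[OF g(1) x] sg(1)[OF g(2)] by simp
    qed
  qed
qed

lemma strong_balanced:
  obtains \<kappa> where "\<kappa> > 0" "\<kappa> \<le> 1" 
    "\<And>n \<alpha>. strong_heights_le (orb T n) (rtime T n) (htime T n) \<Longrightarrow> \<kappa> * tot n \<le> lam n \<alpha>"
proof -
  define K where "K = 4 * total_len T * CARD('a) / c + CARD('a) + 1"
  have K: "K \<ge> 1" using tot_pos[of 0] c_pos by (simp add: K_def)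
  \<comment> \<open>The total is a sum of \<open>CARD('a)\<close> lengths, each at most
    \<open>K ^ CARD('a)\<close> times the given one.\<close>
  define \<kappa> where "\<kappa> = 1 / (real CARD('a) * K ^ CARD('a))"
  have k: "\<kappa> > 0" using K by (simp add: \<kappa>_def)
  have bal: "\<kappa> * tot n \<le> lam n \<alpha>" if "strong_heights_le (orb T n) (rtime T n) (htime T n)" for n \<alpha>
  proof -
    have "lam n x \<le> K ^ CARD('a) * lam n \<alpha>" for x
      by (rule no_gap_imp_bounded_ratio[OF K lam_pos]) (use strong_no_gap[OF that] in \<open>simp add: K_def\<close>)
    hence "tot n \<le> real CARD('a) * (K ^ CARD('a) * lam n \<alpha>)"
      unfolding total_len_def using sum_bounded_above[of UNIV "lam n" "K ^ CARD('a) * lam n \<alpha>"] by simp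
    thus ?thesis using K by (simp add: \<kappa>_def field_simps)
  qed
  have "\<kappa> \<le> 1"
  proof -
    have "\<kappa> * tot 0 \<le> tot 0"
      using bal[of 0 undefined] lam_le_tot[of 0 undefined] by (simp add: strong_heights_le_def)
    thus ?thesis using tot_pos[of 0] by (simp add: mult_le_cancel_right2)
  qed
  with k bal that show ?thesis by blast
qed

end

section \<open>From the times after a top win to all times\<close>

context inf_orbit
begin

lemma strong_Suc: "topwin (orb T n) \<Longrightarrow> strong_heights_le (orb T (Suc n)) (rtime T (Suc n)) (htime T (Suc n))"
  using st.heights_step_top[OF orb_heights] by simp

text \<open>Bottom wins keep the bottom row, so one and the same letter wins throughout and only it
  is shortened.\<close>

lemma bot_run:
  assumes "n \<le> m" "\<And>k. n \<le> k \<Longrightarrow> k < m \<Longrightarrow> \<not> topwin (orb T k)"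
  shows "last_letter (pbot (orb T m)) = st.b n \<and> (\<forall>\<xi>. \<xi> \<noteq> st.b n \<longrightarrow> lam m \<xi> = lam n \<xi>)"
  using assms
proof (induction m rule: dec_induct)
  case (step m)
  hence "\<not> topwin (orb T m)" by simp
  with step show ?case using st.rz_bot[of m] by simp
qed simp

text \<open>Otherwise a single letter would lose at least the fixed amount \<mu> at every
  step.\<close>

lemma topwin_later: "\<exists>m\<ge>n. topwin (orb T m)"
proof (rule ccontr)
  assume "\<not> ?thesis"
  hence bot: "\<not> topwin (orb T k)" if "n \<le> k" for k using that by blast
  let ?b = "st.b n"
  define \<mu> where "\<mu> = Min (range (lam n))"
  have mu: "\<mu> > 0" "\<And>\<xi>. \<mu> \<le> lam n \<xi>" using lam_pos by (auto simp: \<mu>_def)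
  have "lam (n + j) ?b \<le> lam n ?b - real j * \<mu>" for j
  proof (induction j)
    case (Suc j)
    have b: "last_letter (pbot (orb T (n + j))) = ?b" "\<And>\<xi>. \<xi> \<noteq> ?b \<Longrightarrow> lam (n + j) \<xi> = lam n \<xi>"
      using bot_run[of n "n + j"] bot by auto
    have "st.a (n + j) \<noteq> ?b" using st.a_neq_b[of "n + j"] b(1) by simp
    hence "lam (n + j) (st.a (n + j)) \<ge> \<mu>" using b(2) mu(2) by simp
    moreover have "lam (n + Suc j) ?b = lam (n + j) ?b - lam (n + j) (st.a (n + j))"
      using st.rz_bot(1)[OF bot, of "n + j"] b(1) by simp
    ultimately show ?case using Suc by (simp add: algebra_simps)
  qed simp
  moreover obtain j where "real j * \<mu> > lam n ?b" using mu(1) reals_Archimedean3 by blast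
  ultimately show False using lam_pos[of "n + j" ?b] by (smt (verit))
qed

text \<open>Time \<open>n\<close> is enclosed between the last strong time \<open>s\<close> and the
  first top win \<open>m\<close> from \<open>n\<close> on; all steps from \<open>s\<close> up to
  \<open>m\<close> are bottom wins of one letter.\<close>

lemma balanced_all:
  assumes k: "\<kappa> > 0" "\<kappa> \<le> 1"
    and bal: "\<And>n \<alpha>. strong_heights_le (orb T n) (rtime T n) (htime T n) \<Longrightarrow> \<kappa> * tot n \<le> lam n \<alpha>"
  shows "\<kappa>\<^sup>2 * tot n \<le> lam n \<alpha>"
proof -
  define str where "str n \<longleftrightarrow> n = 0 \<or> (\<exists>m. n = Suc m \<and> topwin (orb T m))" for n
  have strong: "\<kappa> * tot n \<le> lam n \<alpha>" if "str n" for n \<alpha>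
  proof (rule bal, cases n)
    case 0 show "strong_heights_le (orb T n) (rtime T n) (htime T n)" by (simp add: 0 strong_heights_le_def)
  next
    case (Suc m) thus "strong_heights_le (orb T n) (rtime T n) (htime T n)" using that strong_Suc[of m] unfolding str_def by blast
  qed
  define s where "s = (GREATEST k. k \<le> n \<and> str k)"
  have "s \<le> n \<and> str s" unfolding s_def
    by (rule GreatestI_nat[of "\<lambda>k. k \<le> n \<and> str k" 0 n]) (auto simp: str_def)
  hence s: "s \<le> n" "str s" by auto
  have s_max: "\<not> str k" if "s < k" "k \<le> n" for k
    using Greatest_le_nat[of "\<lambda>k. k \<le> n \<and> str k" k n] that by (auto simp: s_def)
  have ex: "\<exists>m. n \<le> m \<and> topwin (orb T m)" using topwin_later by blast
  define m where "m = (LEAST m. n \<le> m \<and> topwin (orb T m))"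
  have m: "n \<le> m" "topwin (orb T m)" using LeastI_ex[OF ex] by (auto simp: m_def)
  have m_min: "\<not> topwin (orb T k)" if "n \<le> k" "k < m" for k
    using not_less_Least[of k "\<lambda>m. n \<le> m \<and> topwin (orb T m)"] that by (auto simp: m_def)
  have bot: "\<not> topwin (orb T k)" if "s \<le> k" "k < m" for k
  proof (cases "n \<le> k")
    case False
    hence "\<not> str (Suc k)" using s_max[of "Suc k"] that by simp
    thus ?thesis by (auto simp: str_def)
  qed (use m_min that in auto)
  have sm: "s \<le> m" using s m by simp
  from bot_run[OF sm bot] have r: "st.b m = st.b s" "\<And>\<xi>. \<xi> \<noteq> st.b s \<Longrightarrow> lam m \<xi> = lam s \<xi>" by auto
  \<comment> \<open>\<open>?a\<close> is not the letter winning since \<open>s\<close>, so its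
    length is still that of time \<open>s\<close>; at step \<open>m\<close> it splits into two cells
    of time \<open>Suc m\<close>. This gives one factor \<kappa>, and balance at
    \<open>Suc m\<close> gives the other.\<close>
  let ?a = "st.a m" and ?b = "st.b m"
  have ab: "?a \<noteq> ?b" by (rule st.a_neq_b)
  have "\<kappa> * tot n \<le> \<kappa> * tot s" using tot_antimono[OF s(1)] k by simp
  also have "\<dots> \<le> lam s ?a" by (rule strong[OF s(2)])
  also have "\<dots> = lam m ?a" using r ab by simp
  also have "\<dots> = lam (Suc m) ?a + lam (Suc m) ?b"
    using lam_Suc[of m ?a] st.rz_top(2)[OF m(2)] by (simp del: orb.simps)
  also have "\<dots> = sum (lam (Suc m)) {?a, ?b}" using ab by simp
  also have "\<dots> \<le> tot (Suc m)" unfolding total_len_def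
    by (rule sum_mono2) (auto simp: less_imp_le[OF lam_pos] simp del: orb.simps)
  finally have "\<kappa> * (\<kappa> * tot n) \<le> \<kappa> * tot (Suc m)" using k by simp
  also have "\<dots> \<le> lam (Suc m) \<alpha>" by (rule strong) (use m in \<open>auto simp: str_def\<close>)
  also have "\<dots> \<le> lam n \<alpha>" using m by (intro lam_antimono) simp
  finally show ?thesis by (simp add: power2_eq_square mult.assoc)
qed

subsection \<open>Balanced lengths imply bounded positive acceleration\<close>

text \<open>Stop when the domain first becomes shorter than the shortest cell of time
  \<open>n\<close>: a letter that never won would keep a cell longer than the domain.\<close>

lemma complete_window:
  assumes k: "\<kappa> > 0" "\<kappa> \<le> 1" and bal: "\<And>n \<alpha>. \<kappa> * tot n \<le> lam n \<alpha>"
  shows "\<exists>m>n. \<kappa>\<^sup>2 * tot n \<le> tot m \<and> (\<forall>\<alpha>. \<exists>j. n \<le> j \<and> j < m \<and> w j = \<alpha>)"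
proof -
  define \<mu> where "\<mu> = Min (range (lam n))"
  have "\<mu> \<in> range (lam n)" unfolding \<mu>_def by (rule Min_in) auto
  hence mu: "\<mu> > 0" "\<And>\<xi>. \<mu> \<le> lam n \<xi>" "\<kappa> * tot n \<le> \<mu>" using lam_pos bal by (auto simp: \<mu>_def)
  \<comment> \<open>Each step removes the loser's length, a proportion of at least \<kappa>, so the
    domain shrinks geometrically.\<close>
  have dec: "tot (Suc j) \<le> (1 - \<kappa>) * tot j" for j
    using bal[of j "l j"] st.total_rz[of j] by (simp add: algebra_simps)
  have "tot (n + j) \<le> (1 - \<kappa>) ^ j * tot n" for j
  proof (induction j)
    case (Suc j)
    have "tot (n + Suc j) \<le> (1 - \<kappa>) * tot (n + j)" using dec[of "n + j"] by simp
    also have "\<dots> \<le> (1 - \<kappa>) * ((1 - \<kappa>) ^ j * tot n)" using Suc k by (intro mult_left_mono) auto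
    finally show ?case by (simp add: mult_ac)
  qed simp
  moreover have "\<exists>j. (1 - \<kappa>) ^ j < \<mu> / tot n"
    using real_arch_pow_inv[of "\<mu> / tot n" "1 - \<kappa>"] mu(1) tot_pos[of n] k by simp
  ultimately obtain j where "tot (n + j) < \<mu>"
    using tot_pos[of n] by (metis le_less_trans pos_less_divide_eq)
  hence ex: "\<exists>m. n \<le> m \<and> tot m < \<mu>" by (intro exI[of _ "n + j"]) simp
  define m where "m = (LEAST m. n \<le> m \<and> tot m < \<mu>)"
  have m: "n \<le> m" "tot m < \<mu>" using LeastI_ex[OF ex] by (auto simp: m_def)
  have "m \<noteq> n" using m(2) mu(2)[of undefined] lam_le_tot[of n undefined] by auto
  then obtain m' where m': "m = Suc m'" "n \<le> m'" using m(1) by (cases m) auto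
  hence "\<mu> \<le> tot m'" using not_less_Least[of m' "\<lambda>m. n \<le> m \<and> tot m < \<mu>"] by (auto simp: m_def)
  \<comment> \<open>One step before stopping the domain is still at least \<mu>, and the loser of
    that step keeps its length.\<close>
  have "\<kappa>\<^sup>2 * tot n \<le> \<kappa> * \<mu>" using mu(3) k by (simp add: power2_eq_square mult.assoc)
  also have "\<dots> \<le> \<kappa> * tot m'" using \<open>\<mu> \<le> tot m'\<close> k by simp
  also have "\<dots> \<le> lam m' (l m')" by (rule bal)
  also have "\<dots> = lam m (l m')" using st.winner_neq_loser[of m'] by (simp add: m' st.len_rz)
  also have "\<dots> \<le> tot m" by (rule lam_le_tot)
  finally have 1: "\<kappa>\<^sup>2 * tot n \<le> tot m" .
  have "\<exists>j. n \<le> j \<and> j < m \<and> w j = \<alpha>" for \<alpha>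
  proof (rule ccontr)
    assume c: "\<not> ?thesis"
    have "lam k \<alpha> = lam n \<alpha>" if "n \<le> k" "k \<le> m" for k
      using that
    proof (induction k rule: dec_induct)
      case (step j)
      hence "w j \<noteq> \<alpha>" using c by auto
      with step lam_Suc[of j \<alpha>] show ?case by simp
    qed simp
    from this[of m] m(1) have "lam m \<alpha> = lam n \<alpha>" by simp
    thus False using mu(2)[of \<alpha>] m(2) lam_le_tot[of m \<alpha>] by simp
  qed
  with 1 m' show ?thesis by (intro exI[of _ m]) auto
qed

text \<open>The letters of time \<open>m\<close> whose points visit cell \<alpha> of time
  \<open>n\<close> before returning.\<close>

definition "support n m \<alpha> = {i. cmat T n m $ i $ \<alpha> > 0}"

lemma support_mono: "n \<le> m \<Longrightarrow> m \<le> k \<Longrightarrow> support n m \<alpha> \<subseteq> support n k \<alpha>"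
  unfolding support_def using cmat_mono by (auto intro: less_le_trans)

lemma support_step: "n \<le> m \<Longrightarrow> w m \<in> support n m \<alpha> \<Longrightarrow> l m \<in> support n (Suc m) \<alpha>"
  using cmat_nonneg[of n m "l m" \<alpha>] by (simp add: support_def cmat_Suc)

text \<open>While the support is constant, a loser belongs to it whenever the winner does. A winner keeps
  its place at the end of its row until it loses, so once a winner lies outside the support, so do all later ones.\<close>

lemma support_grows:
  assumes le: "n \<le> m" "m \<le> m1" "m1 \<le> m2"
    and w1: "\<And>\<alpha>. \<exists>j. m \<le> j \<and> j < m1 \<and> w j = \<alpha>" and w2: "\<And>\<alpha>. \<exists>j. m1 \<le> j \<and> j < m2 \<and> w j = \<alpha>"
    and ne: "support n m \<alpha> \<noteq> UNIV"
  shows "card (support n m \<alpha>) < card (support n m2 \<alpha>)"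
proof (rule ccontr)
  let ?S = "support n m \<alpha>"
  assume "\<not> ?thesis"
  hence "?S = support n m2 \<alpha>"
    using support_mono[of n m m2 \<alpha>] le by (intro card_seteq) auto
  hence const: "support n k \<alpha> = ?S" if "m \<le> k" "k \<le> m2" for k
    using support_mono[of n m k \<alpha>] support_mono[of n k m2 \<alpha>] le that by auto
  have lose: "l k \<in> ?S" if "w k \<in> ?S" "m \<le> k" "k < m2" for k
    using support_step[of n k \<alpha>] const[of k] const[of "Suc k"] that le by auto
  obtain \<beta> where "\<beta> \<notin> ?S" using ne by blast
  with w1[of \<beta>] obtain j where j: "m \<le> j" "j < m1" "w j \<notin> ?S" by blast
  have out: "k < m2 \<Longrightarrow> w k \<notin> ?S" if "j \<le> k" for k
    using that
  proof (induction k rule: dec_induct)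
    case (step k)
    hence "w k \<notin> ?S" by simp
    moreover have "w (Suc k) = w k \<or> l (Suc k) = w k"
      using st.winner_persists[of k] st.rauzy_step_axioms[of "Suc k"] by simp
    ultimately show ?case using lose[of "Suc k"] step j by auto
  qed (use j in simp)
  \<comment> \<open>The second window serves this purpose: \<alpha> itself lies in the support and
    wins after \<open>m1\<close>, hence after \<open>j\<close>.\<close>
  have "\<alpha> \<in> support n n \<alpha>" by (simp add: support_def cmat_refl)
  hence "\<alpha> \<in> ?S" using support_mono[of n n m \<alpha>] le by auto
  with w2[of \<alpha>] out j show False by (metis le_trans less_imp_le)
qed

text \<open>Two windows, at a cost of \<kappa> to the fourth power, enlarge every column support
  that is not yet full; \<open>CARD('a)\<close> rounds fill them all.\<close>

lemma positive_bounded: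
  assumes k: "\<kappa> > 0" "\<kappa> \<le> 1" and bal: "\<And>n \<alpha>. \<kappa> * tot n \<le> lam n \<alpha>"
  shows "\<exists>m>n. \<kappa> ^ (4 * CARD('a)) * tot n \<le> tot m \<and> (\<forall>i j. cmat T n m $ i $ j > 0)"
proof -
  have "\<exists>m. n + j \<le> m \<and> \<kappa> ^ (4 * j) * tot n \<le> tot m \<and> (\<forall>\<alpha>. support n m \<alpha> = UNIV \<or> j \<le> card (support n m \<alpha>))" for j
  proof (induction j)
    case 0 show ?case by (intro exI[of _ n]) simp
  next
    case (Suc j)
    then obtain m where m: "n + j \<le> m" "\<kappa> ^ (4 * j) * tot n \<le> tot m"
      "\<And>\<alpha>. support n m \<alpha> = UNIV \<or> j \<le> card (support n m \<alpha>)" by blast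
    obtain m1 where m1: "m1 > m" "\<kappa>\<^sup>2 * tot m \<le> tot m1" "\<And>\<alpha>. \<exists>j. m \<le> j \<and> j < m1 \<and> w j = \<alpha>"
      using complete_window[OF k bal, of m] by blast
    obtain m2 where m2: "m2 > m1" "\<kappa>\<^sup>2 * tot m1 \<le> tot m2" "\<And>\<alpha>. \<exists>j. m1 \<le> j \<and> j < m2 \<and> w j = \<alpha>"
      using complete_window[OF k bal, of m1] by blast
    have "\<kappa> ^ (4 * Suc j) * tot n = \<kappa>\<^sup>2 * (\<kappa>\<^sup>2 * (\<kappa> ^ (4 * j) * tot n))"
      by (simp add: power_add[symmetric] mult.assoc[symmetric] del: mult_Suc_right) (simp add: numeral_eq_Suc)
    also have "\<dots> \<le> \<kappa>\<^sup>2 * (\<kappa>\<^sup>2 * tot m)" using m(2) by (intro mult_left_mono) auto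
    also have "\<dots> \<le> \<kappa>\<^sup>2 * tot m1" using m1(2) by (intro mult_left_mono) auto
    also have "\<dots> \<le> tot m2" by (rule m2)
    finally have "\<kappa> ^ (4 * Suc j) * tot n \<le> tot m2" .
    moreover have "support n m2 \<alpha> = UNIV \<or> Suc j \<le> card (support n m2 \<alpha>)" for \<alpha>
    proof (cases "support n m \<alpha> = UNIV")
      case True thus ?thesis using support_mono[of n m m2 \<alpha>] m m1 m2 by auto
    next
      case False
      have "card (support n m \<alpha>) < card (support n m2 \<alpha>)"
        by (rule support_grows[OF _ _ _ m1(3) m2(3) False]) (use m m1 m2 in auto)
      thus ?thesis using m(3)[of \<alpha>] False by auto
    qed
    moreover have "n + Suc j \<le> m2" using m(1) m1(1) m2(1) by simp
    ultimately show ?case by blast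
  qed
  from this[of "CARD('a)"] obtain m where m: "n + CARD('a) \<le> m" "\<kappa> ^ (4 * CARD('a)) * tot n \<le> tot m"
    "\<And>\<alpha>. support n m \<alpha> = UNIV \<or> CARD('a) \<le> card (support n m \<alpha>)" by blast
  have "support n m \<alpha> = UNIV" for \<alpha>
    using m(3)[of \<alpha>] card_seteq[of UNIV "support n m \<alpha>"] by auto
  hence "cmat T n m $ i $ j > 0" for i j unfolding support_def by blast
  moreover have "n < m" using m(1) card2 by simp
  ultimately show ?thesis using m(2) by blast
qed

text \<open>The first positive time does not exceed the time \<open>m\<close> of
  \<open>positive_bounded\<close>, and entries only grow until then, so bounding them at
  \<open>m\<close> suffices.\<close>

lemma accel_if_balanced:
  assumes k: "\<kappa> > 0" "\<kappa> \<le> 1" and bal: "\<And>n \<alpha>. \<kappa> * tot n \<le> lam n \<alpha>"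
  shows "iterate_partial pos_accel k T \<noteq> None"
    "max_norm (accel_mat (the (iterate_partial pos_accel k T))) \<le> 1 / \<kappa> ^ Suc (4 * CARD('a))"
proof -
  have main: "(\<exists>r. positive_time (orb T n) r) \<and> max_norm (accel_mat (orb T n)) \<le> 1 / \<kappa> ^ Suc (4 * CARD('a))" for n
  proof -
    obtain m where m: "m > n" "\<kappa> ^ (4 * CARD('a)) * tot n \<le> tot m" "\<And>i j. cmat T n m $ i $ j > 0"
      using positive_bounded[OF k bal, of n] by blast
    let ?r = "first_positive_time (orb T n)"
    have pt: "positive_time (orb T n) (m - n)" using m by (simp add: positive_time_orb)
    hence le: "n + ?r \<le> m" using m(1) Least_le[of "positive_time (orb T n)" "m - n"] by (simp add: first_positive_time_def)
    have "\<bar>cmat T n (n + ?r) $ i $ j\<bar> \<le> 1 / \<kappa> ^ Suc (4 * CARD('a))" for i j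
    proof -
      \<comment> \<open>The additional factor \<kappa> compares a single cell of time
        \<open>m\<close> with the domain.\<close>
      have "\<kappa> ^ Suc (4 * CARD('a)) * tot n \<le> lam m i"
        unfolding power_Suc mult.assoc
        by (rule order_trans[OF mult_left_mono[OF m(2)] bal]) (use k in simp)
      hence "cmat T n m $ i $ j * (\<kappa> ^ Suc (4 * CARD('a)) * tot n) \<le> cmat T n m $ i $ j * lam m i"
        using m(1) by (intro mult_left_mono cmat_nonneg) auto
      also have "\<dots> \<le> tot n" using cmat_le[of n m i j] lam_le_tot[of n j] m(1) by simp
      finally have "(cmat T n m $ i $ j * \<kappa> ^ Suc (4 * CARD('a))) * tot n \<le> 1 * tot n" by (simp only: mult.assoc mult_1)
      hence "cmat T n m $ i $ j * \<kappa> ^ Suc (4 * CARD('a)) \<le> 1" using tot_pos[of n] by (simp only: mult_le_cancel_right_pos)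
      hence "cmat T n m $ i $ j \<le> 1 / \<kappa> ^ Suc (4 * CARD('a))" using k by (simp only: pos_le_divide_eq zero_less_power)
      moreover have "cmat T n (n + ?r) $ i $ j \<le> cmat T n m $ i $ j" by (rule cmat_mono) (use le in auto)
      ultimately show ?thesis using cmat_nonneg[of n "n + ?r" i j] by simp
    qed
    thus ?thesis using pt by (auto simp: max_norm_le_iff accel_mat_orb)
  qed
  have "\<exists>n. iterate_partial pos_accel k T = Some (orb T n)"
  proof (induction k)
    case 0 show ?case by (auto intro: exI[of _ 0])
  next
    case (Suc k)
    then obtain n where n: "iterate_partial pos_accel k T = Some (orb T n)" by blast
    with pos_accel_orb main show ?case by auto
  qed
  with main show "iterate_partial pos_accel k T \<noteq> None"
    "max_norm (accel_mat (the (iterate_partial pos_accel k T))) \<le> 1 / \<kappa> ^ Suc (4 * CARD('a))" by auto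
qed

end

section \<open>The equivalence of bounded type and bounded positive acceleration\<close>

theorem corollary4p8:
  fixes T :: "('a::finite) iet"
  assumes "CARD('a) \<ge> 2"
    and "is_iet T"
    and "admissible T"
  shows "bounded_type T \<longleftrightarrow>
    (\<forall>n. iterate_partial pos_accel n T \<noteq> None) \<and>
    (\<exists>C. \<forall>n. max_norm (accel_mat (the (iterate_partial pos_accel n T))) \<le> C)"
proof
  interpret iet_orbit T using assms by unfold_locales
  assume "(\<forall>n. iterate_partial pos_accel n T \<noteq> None) \<and>
    (\<exists>C. \<forall>n. max_norm (accel_mat (the (iterate_partial pos_accel n T))) \<le> C)"
  thus "bounded_type T" using bounded_type_if_accel by blast
next
  assume bt: "bounded_type T"
  have "total_len T > 0" unfolding total_len_def using assms(2) by (intro sum_pos) (auto simp: is_iet_def)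
  from bounded_typeD[OF bt this] obtain c where c: "c > 0"
    "\<And>n p q. n \<ge> 1 \<Longrightarrow> p \<in> sing_idx T n \<Longrightarrow> q \<in> sing_idx T n \<Longrightarrow> p \<noteq> q \<Longrightarrow> c / real n \<le> dist (sing T p) (sing T q)"
    by blast
  interpret sep_iet T c using assms c by unfold_locales
  obtain \<kappa> where k: "\<kappa> > 0" "\<kappa> \<le> 1" 
    "\<And>n \<alpha>. strong_heights_le (orb T n) (rtime T n) (htime T n) \<Longrightarrow> \<kappa> * tot n \<le> lam n \<alpha>"
    using strong_balanced by blast
  have "\<kappa>\<^sup>2 > 0" "\<kappa>\<^sup>2 \<le> 1" using k by (auto simp: power_le_one)
  from accel_if_balanced[OF this balanced_all[OF k]]
  show "(\<forall>n. iterate_partial pos_accel n T \<noteq> None) \<and>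
    (\<exists>C. \<forall>n. max_norm (accel_mat (the (iterate_partial pos_accel n T))) \<le> C)" by blast
qed

end
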